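(* Let $p$ be a positive integer and let $a_1,\ldots,a_{2p-1}$ be real, distinct, non-zero numbers. Let $A_j:=A(a_j)$ for $j=1,\ldots,2p-1$, let $P_a$ be the polynomial defined below, and let $M_{m,p,a}$ ($m\ge 0$) be the matrices defined below. Let $0<R\le\infty$. Suppose that $\det M_{m,p,a}\neq 0$ for all integers $m\geq 0$ and that $$\tau:=\liminf_{m\to\infty}\left|\det M_{m,p,a}\right|^{1/m}>0.$$ Then for every $f,g\in A(B_R)$ the homogeneous Goursat problem $$\Delta^p u=f,\qquad P_a \mid (u-g)$$ has a unique solution $u\in A(B_{\tau R})$.
   Context: $\Delta=\partial^2/\partial x^2+\partial^2/\partial y^2$ is the Laplace operator on $\mathbb R^2$. For $0<R\le\infty$, $B_R=\{(x,y)\in\mathbb R^2: x^2+y^2<R^2\}$, and $A(B_R)$ denotes the algebra of all $C^\infty$ functions $f:B_R\to\mathbb C$ such that for every compact $K\subset B_R$ the homogeneous Taylor series $\sum_{m\ge0} f_m(x,y)$ of $f$ at $0$ (where $f_m(x,y)=\sum_{k+l=m}\frac{1}{k!\,l!}\frac{\partial^m f}{\partial x^k\partial y^l}(0)x^ky^l$) converges absolutely and uniformly to $f$ on $K$. For a real number $a$, $A(a):=\frac{a+i}{a-i}$ (a unimodular complex number). For $a=(a_1,\dots,a_{2p-1})$, $P_a(x,y):=y\prod_{j=1}^{2p-1}(x-a_jy)$. For $m\ge0$, $M_{m,p,a}$ is the $2p\times 2p$ matrix whose first row is $(1,1,\ldots,1)$ and whose $(j+1)$-th row, $j=1,\ldots,2p-1$,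 is $(1,A_j,A_j^2,\ldots,A_j^{p-1},A_j^{m+p+1},A_j^{m+p+2},\ldots,A_j^{m+2p})$. The condition $P_a\mid(u-g)$ means that $u-g=P_a q$ for some real-analytic $q$ (here $q\in A(B_{\tau R})$), i.e. $P_a$ divides $u-g$ in the ring of germs of real-analytic functions at $0$. *)

theory Defs
  imports "HOL-Analysis.Analysis" "Jordan_Normal_Form.Determinant"
begin

definition dx :: "(real \<times> real \<Rightarrow> complex) \<Rightarrow> real \<times> real \<Rightarrow> complex" where
  "dx f = (\<lambda>(x,y). vector_derivative (\<lambda>t::real. f (t, y)) (at x))"

definition dy :: "(real \<times> real \<Rightarrow> complex) \<Rightarrow> real \<times> real \<Rightarrow> complex" where
  "dy f = (\<lambda>(x,y). vector_derivative (\<lambda>t::real. f (x, t)) (at y))"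

fun pdw :: "bool list \<Rightarrow> (real \<times> real \<Rightarrow> complex) \<Rightarrow> real \<times> real \<Rightarrow> complex" where
  "pdw [] f = f"
| "pdw (b # w) f = (if b then dx else dy) (pdw w f)"

definition smooth_on :: "(real \<times> real) set \<Rightarrow> (real \<times> real \<Rightarrow> complex) \<Rightarrow> bool" where
  "smooth_on U f \<longleftrightarrow> (\<forall>w. continuous_on U (pdw w f) \<and>
     (\<forall>z\<in>U. (\<lambda>t. pdw w f (t, snd z)) differentiable (at (fst z)) \<and>
             (\<lambda>t. pdw w f (fst z, t)) differentiable (at (snd z))))"

definition Bdisc :: "ereal \<Rightarrow> (real \<times> real) set" where
  "Bdisc R = {(x,y). ereal (sqrt (x^2 + y^2)) < R}"

definition homTaylor :: "(real \<times> real \<Rightarrow> complex) \<Rightarrow> nat \<Rightarrow> real \<times> real \<Rightarrow> complex" where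
  "homTaylor f m = (\<lambda>(x,y). \<Sum>k\<le>m. of_real (1 / (fact k * fact (m - k)))
       * pdw (replicate k True @ replicate (m - k) False) f (0,0)
       * of_real (x ^ k * y ^ (m - k)))"

definition AB :: "ereal \<Rightarrow> (real \<times> real \<Rightarrow> complex) set" where
  "AB R = {f. smooth_on (Bdisc R) f \<and>
     (\<forall>K. compact K \<and> K \<subseteq> Bdisc R \<longrightarrow>
        uniform_limit K (\<lambda>n z. \<Sum>m<n. homTaylor f m z) f sequentially \<and>
        (\<exists>h. uniform_limit K (\<lambda>n z. \<Sum>m<n. norm (homTaylor f m z)) h sequentially))}"

definition lap :: "(real \<times> real \<Rightarrow> complex) \<Rightarrow> real \<times> real \<Rightarrow> complex" where
  "lap f = (\<lambda>z. dx (dx f) z + dy (dy f) z)"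

definition Aof :: "real \<Rightarrow> complex" where
  "Aof a = (complex_of_real a + \<i>) / (complex_of_real a - \<i>)"

definition Ppoly :: "nat \<Rightarrow> (nat \<Rightarrow> real) \<Rightarrow> real \<times> real \<Rightarrow> complex" where
  "Ppoly p a = (\<lambda>(x,y). of_real (y * (\<Prod>j=1..2*p-1. x - a j * y)))"

definition Mmat :: "nat \<Rightarrow> nat \<Rightarrow> (nat \<Rightarrow> real) \<Rightarrow> complex mat" where
  "Mmat m p a = mat (2*p) (2*p) (\<lambda>(i,c). if i = 0 then 1
       else Aof (a i) ^ (if c < p then c else m + c + 1))"

definition tau :: "nat \<Rightarrow> (nat \<Rightarrow> real) \<Rightarrow> ereal" where
  "tau p a = liminf (\<lambda>m. ereal (norm (Determinant.det (Mmat m p a)) powr (1 / real m)))"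

(* P_a divides h in the ring of germs of real-analytic functions at 0 *)
definition Pdvd :: "nat \<Rightarrow> (nat \<Rightarrow> real) \<Rightarrow> (real \<times> real \<Rightarrow> complex) \<Rightarrow> bool" where
  "Pdvd p a h \<longleftrightarrow> (\<exists>\<epsilon>>0. \<exists>q. q \<in> AB (ereal \<epsilon>) \<and>
       (\<forall>z\<in>Bdisc (ereal \<epsilon>). h z = Ppoly p a z * q z))"

end

theory Submission
  imports Defs "HOL-Complex_Analysis.Cauchy_Integral_Formula"
begin

text \<open>
  In the coordinates \<open>z = x + iy\<close> and \<open>w = x - iy\<close> a function belongs to \<open>A(B\<^sub>R)\<close> iff it is a double
  power series in \<open>z, w\<close> whose coefficients are \<open>O(r\<^bsup>-(k+l)\<^esup>)\<close> for every \<open>r < R\<close>; the coefficients of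
  each homogeneous part are Fourier coefficients of its restriction to a circle. Since
  \<open>\<Delta> = 4 \<partial>\<^sub>z \<partial>\<^sub>w\<close>, the equation \<open>\<Delta>\<^sup>p u = f\<close> prescribes the coefficients of \<open>z\<^sup>k w\<^sup>l\<close> with \<open>k, l \<ge> p\<close> and
  leaves \<open>2p\<close> of them free in each degree \<open>m + 2p\<close>. Divisibility by \<open>P\<^sub>a\<close> means vanishing on the \<open>2p\<close>
  lines \<open>z = A w\<close> with \<open>A \<in> {1, A\<^sub>1, \<dots>}\<close>, which is a linear system with matrix \<open>M\<^bsub>m,p,a\<^esub>\<close> for the free
  coefficients. Its inverse is bounded by a constant over \<open>|det M\<^bsub>m,p,a\<^esub>|\<close>, so the radius of
  convergence shrinks at most by the factor \<open>\<tau>\<close>.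
\<close>

section \<open>Double power series in a complex variable and its conjugate\<close>

text \<open>The coordinates \<open>z\<close>, \<open>w\<close> are forced by the coefficient
  estimates. On a circle the monomials of one degree are distinct frequencies, so a sup norm there
  bounds every coefficient without loss. Real monomials lose a geometric factor: the real part of (x
  + iy)^m has sup norm 1 on the unit circle, but the absolute values of its coefficients add up to
  2^(m-1). The lines also become unimodular: up to constants x - a y is z - A(a) w and y is z - w,
  hence the powers of \<open>Aof\<close> and the row of ones in the matrix. \<open>hpart\<close>
  keeps \<open>z\<close> and \<open>w\<close> independent. Besides w = cnj z it is evaluated at (A,
  1), which reads off the values on a line, and at complex multiples of a pair, where analyticity in
  the multiplier separates the degrees. Two losses are kept apart: factors polynomial in the degree
  disappear when the radius is shrunk slightly, whereas the determinant costs t^(-m) and turns a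
  radius \<sigma> into t \<sigma>.\<close>

definition hpart :: "(nat \<Rightarrow> nat \<Rightarrow> complex) \<Rightarrow> nat \<Rightarrow> complex \<Rightarrow> complex \<Rightarrow> complex" where
  "hpart c m z w = (\<Sum>k\<le>m. c k (m - k) * z ^ k * w ^ (m - k))"

definition zser :: "(nat \<Rightarrow> nat \<Rightarrow> complex) \<Rightarrow> complex \<Rightarrow> complex" where
  "zser c z = (\<Sum>m. hpart c m z (cnj z))"

text \<open>Cauchy-Hadamard convergence on the bidisc of radius \<open>R\<close>, stated through the
  smaller radii because a bound at \<open>R\<close> itself may fail and \<open>R\<close> may be
  infinite.\<close>

definition geom_bdd :: "ereal \<Rightarrow> (nat \<Rightarrow> nat \<Rightarrow> complex) \<Rightarrow> bool" where
  "geom_bdd R c \<longleftrightarrow> (\<forall>r>0. ereal r < R \<longrightarrow> (\<exists>C. \<forall>k l. norm (c k l) * r ^ (k + l) \<le> C))"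

definition Dz :: "(nat \<Rightarrow> nat \<Rightarrow> complex) \<Rightarrow> nat \<Rightarrow> nat \<Rightarrow> complex" where
  "Dz c = (\<lambda>k l. of_nat (Suc k) * c (Suc k) l)"

definition Dw :: "(nat \<Rightarrow> nat \<Rightarrow> complex) \<Rightarrow> nat \<Rightarrow> nat \<Rightarrow> complex" where
  "Dw c = (\<lambda>k l. of_nat (Suc l) * c k (Suc l))"

section \<open>Geometric bounds on double sequences\<close>

lemma geom_bddD:
  assumes "geom_bdd R c" "r > 0" "ereal r < R"
  obtains C where "C \<ge> 0" "\<And>k l. norm (c k l) \<le> C / r ^ (k + l)"
proof -
  obtain C where C: "\<And>k l. norm (c k l) * r ^ (k + l) \<le> C"
    using assms unfolding geom_bdd_def by blast
  have "0 \<le> norm (c 0 0) * r ^ (0 + 0)" by simp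
  also have "\<dots> \<le> C" by (rule C)
  finally have "C \<ge> 0" .
  moreover have "norm (c k l) \<le> C / r ^ (k + l)" for k l
    using C[of k l] assms(2) by (simp add: field_simps)
  ultimately show ?thesis using that by blast
qed

lemma summable_Suc_mult_power:
  fixes x :: real
  assumes "0 \<le> x" "x < 1"
  shows "summable (\<lambda>m. real (Suc m) * x ^ m)"
  using geometric_deriv_sums[of x] assms by (auto simp: sums_iff)

lemma Suc_mult_power_bounded:
  fixes x :: real
  assumes "0 \<le> x" "x < 1"
  obtains B where "\<And>m. real (Suc m) * x ^ m \<le> B"
proof -
  have "bounded (range (\<lambda>m. real (Suc m) * x ^ m))"
    using summable_imp_bounded[OF summable_Suc_mult_power[OF assms]] .
  then obtain B where "\<forall>y\<in>range (\<lambda>m. real (Suc m) * x ^ m). norm y \<le> B"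
    by (auto simp: bounded_iff)
  then have "\<And>m. real (Suc m) * x ^ m \<le> B" by (auto simp: abs_le_iff)
  then show ?thesis using that by blast
qed

lemma ereal_between_real:
  assumes "ereal r < R" "r \<ge> 0"
  obtains s where "s > r" "s > 0" "ereal s < R"
proof -
  obtain x where x: "ereal r < x" "x < R" using assms(1) dense by blast
  then obtain s where "x = ereal s" using assms
    by (cases x) auto
  then show ?thesis using x assms that[of s] by auto
qed

text \<open>A factor linear in the degree is free: pass from \<open>r\<close> to some
  \<open>s > r\<close>, where \<open>real (Suc m) * (r / s) ^ m\<close> stays bounded. Derivatives
  and quotients of series are estimated through this rule.\<close>

lemma geom_bddI:
  assumes "\<And>s. s > 0 \<Longrightarrow> ereal s < R \<Longrightarrow>
    \<exists>C. \<forall>k l. norm (c k l) \<le> C * real (Suc (k + l)) / s ^ (k + l)"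
  shows "geom_bdd R c"
  unfolding geom_bdd_def
proof (intro allI impI)
  fix r :: real assume r: "r > 0" "ereal r < R"
  then obtain s where s: "s > r" "s > 0" "ereal s < R" using ereal_between_real[of r R] by auto
  obtain C where C: "\<And>k l. norm (c k l) \<le> C * real (Suc (k + l)) / s ^ (k + l)"
    using assms s by blast
  obtain B where B: "\<And>m. real (Suc m) * (r / s) ^ m \<le> B"
    using Suc_mult_power_bounded[of "r / s"] r s by auto
  have "0 \<le> norm (c 0 0)" by simp
  also have "\<dots> \<le> C" using C[of 0 0] by simp
  finally have C0: "C \<ge> 0" .
  have "norm (c k l) * r ^ (k + l) \<le> C * B" for k l
  proof -
    have "norm (c k l) * r ^ (k + l) \<le> (C * real (Suc (k + l)) / s ^ (k + l)) * r ^ (k + l)"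
      using C r by (intro mult_right_mono) auto
    also have "\<dots> = C * (real (Suc (k + l)) * (r / s) ^ (k + l))"
      by (simp add: power_divide)
    also have "\<dots> \<le> C * B" using B[of "k + l"] C0 by (intro mult_left_mono) auto
    finally show ?thesis .
  qed
  then show "\<exists>C. \<forall>k l. norm (c k l) * r ^ (k + l) \<le> C" by blast
qed

lemma geom_bdd_mono: "geom_bdd R c \<Longrightarrow> R' \<le> R \<Longrightarrow> geom_bdd R' c"
  unfolding geom_bdd_def by (meson order_less_le_trans)

lemma geom_bdd_lincomb:
  assumes "geom_bdd R c" "geom_bdd R d"
  shows "geom_bdd R (\<lambda>k l. a * c k l + b * d k l)"
proof (rule geom_bddI)
  fix s :: real assume s: "s > 0" "ereal s < R"
  obtain C where C: "C \<ge> 0" "\<And>k l. norm (c k l) \<le> C / s ^ (k + l)" using geom_bddD[OF assms(1) s] by blast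
  obtain D where D: "D \<ge> 0" "\<And>k l. norm (d k l) \<le> D / s ^ (k + l)" using geom_bddD[OF assms(2) s] by blast
  let ?E = "norm a * C + norm b * D"
  have E0: "?E \<ge> 0" using C D by simp
  have "norm (a * c k l + b * d k l) \<le> ?E * real (Suc (k + l)) / s ^ (k + l)" for k l
  proof -
    have "norm (a * c k l + b * d k l) \<le> norm a * norm (c k l) + norm b * norm (d k l)"
      by (metis norm_mult norm_triangle_ineq)
    also have "\<dots> \<le> norm a * (C / s ^ (k + l)) + norm b * (D / s ^ (k + l))"
      using C D by (intro add_mono mult_left_mono) auto
    also have "\<dots> = ?E * 1 / s ^ (k + l)" by (simp add: add_divide_distrib)
    also have "\<dots> \<le> ?E * real (Suc (k + l)) / s ^ (k + l)"
      using E0 s by (intro divide_right_mono mult_left_mono) auto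
    finally show ?thesis .
  qed
  then show "\<exists>C. \<forall>k l. norm (a * c k l + b * d k l) \<le> C * real (Suc (k + l)) / s ^ (k + l)" by blast
qed

lemma geom_bdd_Dz:
  assumes "geom_bdd R c"
  shows "geom_bdd R (Dz c)"
proof (rule geom_bddI)
  fix s :: real assume s: "s > 0" "ereal s < R"
  obtain C where C: "C \<ge> 0" "\<And>k l. norm (c k l) \<le> C / s ^ (k + l)" using geom_bddD[OF assms s] by blast
  have "norm (Dz c k l) \<le> (C / s) * real (Suc (k + l)) / s ^ (k + l)" for k l
  proof -
    have "norm (Dz c k l) = real (Suc k) * norm (c (Suc k) l)"
      unfolding Dz_def norm_mult by (simp del: of_nat_Suc)
    also have "\<dots> \<le> real (Suc (k + l)) * (C / s ^ (Suc k + l))"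
      using C(1) s by (intro mult_mono C(2)) auto
    also have "\<dots> = (C / s) * real (Suc (k + l)) / s ^ (k + l)" by simp
    finally show ?thesis .
  qed
  then show "\<exists>C. \<forall>k l. norm (Dz c k l) \<le> C * real (Suc (k + l)) / s ^ (k + l)" by blast
qed

lemma geom_bdd_Dw:
  assumes "geom_bdd R c"
  shows "geom_bdd R (Dw c)"
proof (rule geom_bddI)
  fix s :: real assume s: "s > 0" "ereal s < R"
  obtain C where C: "C \<ge> 0" "\<And>k l. norm (c k l) \<le> C / s ^ (k + l)" using geom_bddD[OF assms s] by blast
  have "norm (Dw c k l) \<le> (C / s) * real (Suc (k + l)) / s ^ (k + l)" for k l
  proof -
    have "norm (Dw c k l) = real (Suc l) * norm (c k (Suc l))"
      unfolding Dw_def norm_mult by (simp del: of_nat_Suc)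
    also have "\<dots> \<le> real (Suc (k + l)) * (C / s ^ (k + Suc l))"
      using C(1) s by (intro mult_mono C(2)) auto
    also have "\<dots> = (C / s) * real (Suc (k + l)) / s ^ (k + l)" by simp
    finally show ?thesis .
  qed
  then show "\<exists>C. \<forall>k l. norm (Dw c k l) \<le> C * real (Suc (k + l)) / s ^ (k + l)" by blast
qed

text \<open>The majorant depends on the radius only and holds for independent \<open>z\<close> and
  \<open>w\<close>; the Weierstrass test is fed with it throughout.\<close>

lemma hpart_bound:
  assumes "geom_bdd R c" "0 \<le> r" "ereal r < R"
  obtains M where "summable M"
    "\<And>m z w. norm z \<le> r \<Longrightarrow> norm w \<le> r \<Longrightarrow> norm (hpart c m z w) \<le> M m"
proof -
  obtain s where s: "s > r" "s > 0" "ereal s < R" using ereal_between_real assms by blast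
  obtain C where C: "C \<ge> 0" "\<And>k l. norm (c k l) \<le> C / s ^ (k + l)"
    using geom_bddD[OF assms(1) s(2,3)] by blast
  show ?thesis
  proof (rule that[of "\<lambda>m. C * (real (Suc m) * (r / s) ^ m)"])
    show "summable (\<lambda>m. C * (real (Suc m) * (r / s) ^ m))"
      using s assms by (intro summable_mult summable_Suc_mult_power) auto
  next
    fix m z w assume zw: "norm (z::complex) \<le> r" "norm (w::complex) \<le> r"
    have "norm (hpart c m z w) \<le> (\<Sum>k\<le>m. C * (r / s) ^ m)"
      unfolding hpart_def
    proof (rule sum_norm_le)
      fix k assume k: "k \<in> {..m}"
      have "norm (c k (m - k) * z ^ k * w ^ (m - k)) = norm (c k (m - k)) * norm z ^ k * norm w ^ (m - k)"
        by (simp add: norm_mult norm_power)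
      also have "\<dots> \<le> C / s ^ (k + (m - k)) * r ^ k * r ^ (m - k)"
        using zw s C assms by (intro mult_mono power_mono) auto
      also have "\<dots> = C * (r / s) ^ m"
        using k by (simp add: power_divide mult.assoc flip: power_add)
      finally show "norm (c k (m - k) * z ^ k * w ^ (m - k)) \<le> C * (r / s) ^ m" .
    qed
    also have "\<dots> = C * (real (Suc m) * (r / s) ^ m)" by simp
    finally show "norm (hpart c m z w) \<le> C * (real (Suc m) * (r / s) ^ m)" .
  qed
qed

lemma summable_hpart:
  assumes "geom_bdd R c" "ereal (norm z) < R" "ereal (norm w) < R"
  shows "summable (\<lambda>m. hpart c m z w)"
proof -
  have "ereal (max (norm z) (norm w)) < R" using assms by (simp add: max_def)
  then obtain M where M: "summable M" "\<And>m z' w'. norm z' \<le> max (norm z) (norm w) \<Longrightarrow> norm w' \<le> max (norm z) (norm w) \<Longrightarrow> norm (hpart c m z' w') \<le> M m"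
    using hpart_bound[OF assms(1), of "max (norm z) (norm w)"] by (auto simp: le_max_iff_disj)
  show ?thesis by (rule summable_comparison_test'[OF M(1)]) (use M(2) in auto)
qed

lemma zser_sums:
  assumes "geom_bdd R c" "ereal (norm z) < R"
  shows "(\<lambda>m. hpart c m z (cnj z)) sums zser c z"
  unfolding zser_def by (intro summable_sums summable_hpart[OF assms(1)]) (use assms in auto)

lemma uniform_limit_zser:
  assumes "geom_bdd R c" "0 \<le> r" "ereal r < R"
  shows "uniform_limit (cball 0 r) (\<lambda>n z. \<Sum>m<n. hpart c m z (cnj z)) (zser c) sequentially"
proof -
  obtain M where M: "summable M"
    "\<And>m z w. norm z \<le> r \<Longrightarrow> norm w \<le> r \<Longrightarrow> norm (hpart c m z w) \<le> M m"
    using hpart_bound[OF assms] by blast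
  show ?thesis unfolding zser_def
    by (rule Weierstrass_m_test[OF _ M(1)]) (use M(2) in auto)
qed

lemma hpart_lincomb:
  "hpart (\<lambda>k l. a * c k l + b * d k l) m z w = a * hpart c m z w + b * hpart d m z w"
  unfolding hpart_def sum_distrib_left sum.distrib[symmetric]
  by (intro sum.cong) (auto simp: algebra_simps)

lemma zser_lincomb:
  assumes "geom_bdd R c" "geom_bdd R d" "ereal (norm z) < R"
  shows "zser (\<lambda>k l. a * c k l + b * d k l) z = a * zser c z + b * zser d z"
proof -
  have "(\<lambda>m. a * hpart c m z (cnj z) + b * hpart d m z (cnj z)) sums (a * zser c z + b * zser d z)"
    using assms by (intro sums_add sums_mult zser_sums)
  then show ?thesis unfolding zser_def hpart_lincomb by (simp add: sums_iff)
qed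

text \<open>Wirtinger form of the real derivative: \<open>cnj\<close> is only real-differentiable,
  so \<open>Dz\<close> and \<open>Dw\<close> act on \<open>h\<close> and \<open>cnj h\<close>
  separately. The degree drops by one, hence \<open>Suc m\<close>.\<close>

lemma hpart_Suc_has_derivative:
  "((\<lambda>z. hpart c (Suc m) z (cnj z)) has_derivative
     (\<lambda>h. hpart (Dz c) m z (cnj z) * h + hpart (Dw c) m z (cnj z) * cnj h)) (at z)"
proof -
  have 1: "((\<lambda>z. a * z ^ k * cnj z ^ l) has_derivative
     (\<lambda>h. a * (of_nat k * z ^ (k - 1)) * cnj z ^ l * h + a * z ^ k * (of_nat l * cnj z ^ (l - 1)) * cnj h)) (at z)" for a :: complex and k l
    by (rule derivative_eq_intros refl | simp add: algebra_simps)+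
  have "((\<lambda>z. hpart c (Suc m) z (cnj z)) has_derivative
     (\<lambda>h. \<Sum>k\<le>Suc m. c k (Suc m - k) * (of_nat k * z ^ (k - 1)) * cnj z ^ (Suc m - k) * h
       + c k (Suc m - k) * z ^ k * (of_nat (Suc m - k) * cnj z ^ (Suc m - k - 1)) * cnj h)) (at z)"
    unfolding hpart_def by (intro has_derivative_sum 1)
  also have "(\<lambda>h. \<Sum>k\<le>Suc m. c k (Suc m - k) * (of_nat k * z ^ (k - 1)) * cnj z ^ (Suc m - k) * h
       + c k (Suc m - k) * z ^ k * (of_nat (Suc m - k) * cnj z ^ (Suc m - k - 1)) * cnj h)
     = (\<lambda>h. hpart (Dz c) m z (cnj z) * h + hpart (Dw c) m z (cnj z) * cnj h)"
  proof
    fix h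
    have A: "(\<Sum>k\<le>Suc m. c k (Suc m - k) * (of_nat k * z ^ (k - 1)) * cnj z ^ (Suc m - k) * h) = hpart (Dz c) m z (cnj z) * h"
      unfolding sum.atMost_Suc_shift hpart_def Dz_def sum_distrib_right
      by (simp add: mult_ac del: of_nat_Suc)
    have B: "(\<Sum>k\<le>Suc m. c k (Suc m - k) * z ^ k * (of_nat (Suc m - k) * cnj z ^ (Suc m - k - 1)) * cnj h) = hpart (Dw c) m z (cnj z) * cnj h"
      unfolding hpart_def Dw_def sum_distrib_right
      by (simp add: Suc_diff_le mult_ac del: of_nat_Suc of_nat_diff cong: sum.cong_simp)
    show "(\<Sum>k\<le>Suc m. c k (Suc m - k) * (of_nat k * z ^ (k - 1)) * cnj z ^ (Suc m - k) * h
       + c k (Suc m - k) * z ^ k * (of_nat (Suc m - k) * cnj z ^ (Suc m - k - 1)) * cnj h)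
     = hpart (Dz c) m z (cnj z) * h + hpart (Dw c) m z (cnj z) * cnj h"
      unfolding sum.distrib A B ..
  qed
  finally show ?thesis .
qed

lemma zser_has_derivative:
  assumes c: "geom_bdd R c" and z: "ereal (norm z) < R"
  shows "(zser c has_derivative (\<lambda>h. zser (Dz c) z * h + zser (Dw c) z * cnj h)) (at z)"
proof -
  obtain r where r: "norm z < r" "r > 0" "ereal r < R" using ereal_between_real[OF z] by auto
  let ?S = "ball (0::complex) r"
  \<comment> \<open>Degree 0 is constant and contributes nothing, so the derivatives of the first
    \<open>Suc n\<close> terms are the first \<open>n\<close> terms of the series of
    \<open>Dz c\<close> and \<open>Dw c\<close>.\<close>
  let ?f' = "\<lambda>m x h. case m of 0 \<Rightarrow> 0 | Suc m \<Rightarrow> hpart (Dz c) m x (cnj x) * h + hpart (Dw c) m x (cnj x) * cnj h"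
  have ul: "uniform_limit (cball 0 r) (\<lambda>n z. \<Sum>m<n. hpart d m z (cnj z)) (zser d) sequentially" if "geom_bdd R d" for d
    using uniform_limit_zser[OF that] r by auto
  have "\<exists>g. \<forall>x\<in>?S. (\<lambda>n. hpart c n x (cnj x)) sums (g x) \<and>
     (g has_derivative (\<lambda>h. zser (Dz c) x * h + zser (Dw c) x * cnj h)) (at x within ?S)"
  proof (rule has_derivative_series[where f' = ?f' and x = z])
    show "convex ?S" by simp
    show "z \<in> ?S" using r by simp
    show "(\<lambda>n. hpart c n z (cnj z)) sums zser c z" using zser_sums[OF c z] .
    show "((\<lambda>x. hpart c n x (cnj x)) has_derivative ?f' n x) (at x within ?S)" for n x
    proof (cases n)
      case 0 then show ?thesis by (simp add: hpart_def)
    next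
      case (Suc m)
      then show ?thesis using hpart_Suc_has_derivative[of c m x] by (simp add: has_derivative_at_withinI)
    qed
    show "\<forall>\<^sub>F n in sequentially. \<forall>x\<in>?S. \<forall>h. norm ((\<Sum>i<n. ?f' i x h) - (zser (Dz c) x * h + zser (Dw c) x * cnj h)) \<le> e * norm h"
      if e: "e > 0" for e
    proof -
      have "\<forall>\<^sub>F n in sequentially. \<forall>x\<in>cball 0 r. dist (\<Sum>m<n. hpart (Dz c) m x (cnj x)) (zser (Dz c) x) < e / 2"
        using uniform_limitD[OF ul[OF geom_bdd_Dz[OF c]], of "e / 2"] e by simp
      moreover have "\<forall>\<^sub>F n in sequentially. \<forall>x\<in>cball 0 r. dist (\<Sum>m<n. hpart (Dw c) m x (cnj x)) (zser (Dw c) x) < e / 2"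
        using uniform_limitD[OF ul[OF geom_bdd_Dw[OF c]], of "e / 2"] e by simp
      ultimately have "\<forall>\<^sub>F n in sequentially. \<forall>x\<in>?S. \<forall>h. norm ((\<Sum>i<Suc n. ?f' i x h) - (zser (Dz c) x * h + zser (Dw c) x * cnj h)) \<le> e * norm h"
      proof eventually_elim
        case (elim n)
        show ?case
        proof (intro ballI allI)
          fix x h assume x: "x \<in> ?S"
          let ?A = "(\<Sum>m<n. hpart (Dz c) m x (cnj x)) - zser (Dz c) x"
          let ?B = "(\<Sum>m<n. hpart (Dw c) m x (cnj x)) - zser (Dw c) x"
          have "x \<in> cball 0 r" using x by simp
          then have AB: "norm ?A \<le> e / 2" "norm ?B \<le> e / 2"
            using elim by (metis dist_norm less_imp_le)+
          have eq: "(\<Sum>i<Suc n. ?f' i x h) - (zser (Dz c) x * h + zser (Dw c) x * cnj h) = ?A * h + ?B * cnj h"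
            unfolding sum.lessThan_Suc_shift by (simp add: sum.distrib sum_distrib_right left_diff_distrib)
          have "norm (?A * h + ?B * cnj h) \<le> norm ?A * norm h + norm ?B * norm h"
            by (metis norm_mult norm_triangle_ineq complex_mod_cnj)
          also have "\<dots> \<le> (e / 2) * norm h + (e / 2) * norm h"
            using AB by (intro add_mono mult_right_mono) simp_all
          also have "\<dots> = e * norm h" by simp
          finally show "norm ((\<Sum>i<Suc n. ?f' i x h) - (zser (Dz c) x * h + zser (Dw c) x * cnj h)) \<le> e * norm h"
            unfolding eq .
        qed
      qed
      then show ?thesis by (rule eventually_sequentially_Suc[THEN iffD1])
    qed
  qed
  then obtain g where g: "\<And>x. x \<in> ?S \<Longrightarrow> (\<lambda>n. hpart c n x (cnj x)) sums (g x)"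
    "\<And>x. x \<in> ?S \<Longrightarrow> (g has_derivative (\<lambda>h. zser (Dz c) x * h + zser (Dw c) x * cnj h)) (at x within ?S)" by blast
  have zS: "z \<in> ?S" using r by simp
  have gd: "(g has_derivative (\<lambda>h. zser (Dz c) z * h + zser (Dw c) z * cnj h)) (at z)"
    using g(2)[OF zS] zS at_within_open[of z ?S] by simp
  have gz: "g x = zser c x" if "x \<in> ?S" for x
    using g(1)[OF that] unfolding zser_def by (simp add: sums_iff)
  show ?thesis
    by (rule has_derivative_transform_within_open[OF gd open_ball zS gz])
qed

section \<open>Derivatives and Taylor expansions\<close>

definition Dx :: "(nat \<Rightarrow> nat \<Rightarrow> complex) \<Rightarrow> nat \<Rightarrow> nat \<Rightarrow> complex" where
  "Dx c = (\<lambda>k l. 1 * Dz c k l + 1 * Dw c k l)"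

definition Dy :: "(nat \<Rightarrow> nat \<Rightarrow> complex) \<Rightarrow> nat \<Rightarrow> nat \<Rightarrow> complex" where
  "Dy c = (\<lambda>k l. \<i> * Dz c k l + (- \<i>) * Dw c k l)"

lemma geom_bdd_Dx: "geom_bdd R c \<Longrightarrow> geom_bdd R (Dx c)"
  unfolding Dx_def by (intro geom_bdd_lincomb geom_bdd_Dz geom_bdd_Dw)

lemma geom_bdd_Dy: "geom_bdd R c \<Longrightarrow> geom_bdd R (Dy c)"
  unfolding Dy_def by (intro geom_bdd_lincomb geom_bdd_Dz geom_bdd_Dw)

lemma in_Bdisc_iff: "z \<in> Bdisc R \<longleftrightarrow> ereal (norm (Complex (fst z) (snd z))) < R"
  by (cases z) (simp add: Bdisc_def complex_norm)

lemma open_Bdisc: "open (Bdisc R)"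
proof (cases R)
  case (real r)
  have "Bdisc R = (\<lambda>z. Complex (fst z) (snd z)) -` ball 0 r"
    by (auto simp: in_Bdisc_iff real)
  moreover have "continuous_on UNIV (\<lambda>z. Complex (fst z) (snd z))"
    unfolding Complex_eq by (intro continuous_intros)
  ultimately show ?thesis by (metis open_vimage open_ball)
next
  case PInf
  have "Bdisc R = UNIV" by (auto simp: Bdisc_def PInf)
  then show ?thesis by simp
next
  case MInf
  have "Bdisc R = {}" by (auto simp: Bdisc_def MInf)
  then show ?thesis by simp
qed

text \<open>\<open>F\<close> is arbitrary outside the disc; as the disc is open, the values inside
  still determine the partial derivatives there.\<close>

definition zrep :: "ereal \<Rightarrow> (real \<times> real \<Rightarrow> complex) \<Rightarrow> (nat \<Rightarrow> nat \<Rightarrow> complex) \<Rightarrow> bool" where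
  "zrep R F c \<longleftrightarrow> geom_bdd R c \<and> (\<forall>z\<in>Bdisc R. F z = zser c (Complex (fst z) (snd z)))"

lemma zser_partial_x:
  assumes "geom_bdd R c" "(x, y) \<in> Bdisc R"
  shows "((\<lambda>t. zser c (Complex t y)) has_vector_derivative zser (Dx c) (Complex x y)) (at x)"
proof -
  have n: "ereal (norm (Complex x y)) < R" using assms(2) by (simp add: in_Bdisc_iff)
  have 1: "((\<lambda>t. Complex t y) has_derivative of_real) (at x)"
    unfolding Complex_eq by (auto intro!: derivative_eq_intros)
  have "((\<lambda>t. zser c (Complex t y)) has_derivative
      (\<lambda>h. zser (Dz c) (Complex x y) * of_real h + zser (Dw c) (Complex x y) * cnj (of_real h))) (at x)"
    by (rule has_derivative_compose[OF 1 zser_has_derivative[OF assms(1) n]])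
  also have "(\<lambda>h. zser (Dz c) (Complex x y) * of_real h + zser (Dw c) (Complex x y) * cnj (of_real h))
     = (\<lambda>h. h *\<^sub>R zser (Dx c) (Complex x y))"
    unfolding Dx_def zser_lincomb[OF geom_bdd_Dz[OF assms(1)] geom_bdd_Dw[OF assms(1)] n]
    by (auto simp: scaleR_conv_of_real algebra_simps)
  finally show ?thesis unfolding has_vector_derivative_def .
qed

lemma zser_partial_y:
  assumes "geom_bdd R c" "(x, y) \<in> Bdisc R"
  shows "((\<lambda>t. zser c (Complex x t)) has_vector_derivative zser (Dy c) (Complex x y)) (at y)"
proof -
  have n: "ereal (norm (Complex x y)) < R" using assms(2) by (simp add: in_Bdisc_iff)
  have 1: "((\<lambda>t. Complex x t) has_derivative (\<lambda>h. \<i> * of_real h)) (at y)"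
    unfolding Complex_eq by (auto intro!: derivative_eq_intros)
  have "((\<lambda>t. zser c (Complex x t)) has_derivative
      (\<lambda>h. zser (Dz c) (Complex x y) * (\<i> * of_real h) + zser (Dw c) (Complex x y) * cnj (\<i> * of_real h))) (at y)"
    by (rule has_derivative_compose[OF 1 zser_has_derivative[OF assms(1) n]])
  also have "(\<lambda>h. zser (Dz c) (Complex x y) * (\<i> * of_real h) + zser (Dw c) (Complex x y) * cnj (\<i> * of_real h))
     = (\<lambda>h. h *\<^sub>R zser (Dy c) (Complex x y))"
    unfolding Dy_def zser_lincomb[OF geom_bdd_Dz[OF assms(1)] geom_bdd_Dw[OF assms(1)] n]
    by (auto simp: scaleR_conv_of_real algebra_simps)
  finally show ?thesis unfolding has_vector_derivative_def .
qed

lemma zrep_partial_x: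
  assumes "zrep R F c" "(x, y) \<in> Bdisc R"
  shows "((\<lambda>t. F (t, y)) has_vector_derivative zser (Dx c) (Complex x y)) (at x)"
proof (rule has_vector_derivative_transform_within_open)
  show "((\<lambda>t. zser c (Complex t y)) has_vector_derivative zser (Dx c) (Complex x y)) (at x)"
    using assms by (intro zser_partial_x) (auto simp: zrep_def)
  have "continuous_on UNIV (\<lambda>t::real. (t, y))" by (intro continuous_intros)
  then show "open ((\<lambda>t::real. (t, y)) -` Bdisc R)" by (metis open_vimage open_Bdisc)
  show "x \<in> (\<lambda>t::real. (t, y)) -` Bdisc R" using assms by simp
  show "zser c (Complex t y) = F (t, y)" if "t \<in> (\<lambda>t::real. (t, y)) -` Bdisc R" for t
    using assms that by (auto simp: zrep_def)
qed

lemma zrep_partial_y: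
  assumes "zrep R F c" "(x, y) \<in> Bdisc R"
  shows "((\<lambda>t. F (x, t)) has_vector_derivative zser (Dy c) (Complex x y)) (at y)"
proof (rule has_vector_derivative_transform_within_open)
  show "((\<lambda>t. zser c (Complex x t)) has_vector_derivative zser (Dy c) (Complex x y)) (at y)"
    using assms by (intro zser_partial_y) (auto simp: zrep_def)
  have "continuous_on UNIV (\<lambda>t::real. (x, t))" by (intro continuous_intros)
  then show "open ((\<lambda>t::real. (x, t)) -` Bdisc R)" by (metis open_vimage open_Bdisc)
  show "y \<in> (\<lambda>t::real. (x, t)) -` Bdisc R" using assms by simp
  show "zser c (Complex x t) = F (x, t)" if "t \<in> (\<lambda>t::real. (x, t)) -` Bdisc R" for t
    using assms that by (auto simp: zrep_def)
qed

lemma zrep_dx: "zrep R F c \<Longrightarrow> zrep R (dx F) (Dx c)"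
  using zrep_partial_x[of R F c, THEN vector_derivative_at]
  by (auto simp: zrep_def dx_def geom_bdd_Dx)

lemma zrep_dy: "zrep R F c \<Longrightarrow> zrep R (dy F) (Dy c)"
  using zrep_partial_y[of R F c, THEN vector_derivative_at]
  by (auto simp: zrep_def dy_def geom_bdd_Dy)

lemma zrep_lincomb:
  "zrep R F c \<Longrightarrow> zrep R G d \<Longrightarrow> zrep R (\<lambda>z. a * F z + b * G z) (\<lambda>k l. a * c k l + b * d k l)"
  by (auto simp: zrep_def geom_bdd_lincomb zser_lincomb in_Bdisc_iff)

lemma zrep_pdw: "zrep R F c \<Longrightarrow> \<exists>d. zrep R (pdw w F) d"
  by (induction w) (auto intro: zrep_dx zrep_dy)

lemma zrep_pdw_replicate:
  assumes "zrep R F c"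
  shows "zrep R (pdw (replicate k True @ replicate l False) F) ((Dx ^^ k) ((Dy ^^ l) c))"
proof (induction k)
  case 0
  show ?case by (induction l) (simp_all add: assms zrep_dy)
next
  case (Suc k) then show ?case by (simp add: zrep_dx)
qed

lemma zrep_continuous_on:
  assumes "zrep R F c"
  shows "continuous_on (Bdisc R) F"
proof -
  have c: "geom_bdd R c" using assms by (simp add: zrep_def)
  have "continuous_on (Bdisc R) (\<lambda>z. zser c (Complex (fst z) (snd z)))"
  proof (rule continuous_on_compose2[of "{z. ereal (norm z) < R}" "zser c"])
    show "continuous_on {z. ereal (norm z) < R} (zser c)"
      by (intro continuous_at_imp_continuous_on ballI)
        (use zser_has_derivative[OF c] has_derivative_continuous in blast)
    show "continuous_on (Bdisc R) (\<lambda>z. Complex (fst z) (snd z))"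
      unfolding Complex_eq by (intro continuous_intros)
  qed (auto simp: in_Bdisc_iff)
  then show ?thesis using assms by (simp add: zrep_def cong: continuous_on_cong)
qed

lemma zrep_smooth_on:
  assumes "zrep R F c"
  shows "smooth_on (Bdisc R) F"
  unfolding smooth_on_def
proof (intro allI conjI ballI)
  fix w
  obtain d where d: "zrep R (pdw w F) d" using zrep_pdw assms by blast
  show "continuous_on (Bdisc R) (pdw w F)" using d by (rule zrep_continuous_on)
  fix z :: "real \<times> real" assume "z \<in> Bdisc R"
  then show "(\<lambda>t. pdw w F (t, snd z)) differentiable at (fst z)"
    "(\<lambda>t. pdw w F (fst z, t)) differentiable at (snd z)"
    using zrep_partial_x[OF d, of "fst z" "snd z"] zrep_partial_y[OF d, of "fst z" "snd z"]
    by (auto intro: differentiableI_vector)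
qed

section \<open>Homogeneous Taylor polynomials\<close>

lemma hpart_0 [simp]: "hpart c 0 z w = c 0 0"
  by (simp add: hpart_def)

lemma hpart_at_0: "hpart c m 0 0 = (if m = 0 then c 0 0 else 0)"
proof (cases m)
  case (Suc n)
  have "hpart c m 0 0 = (\<Sum>k\<le>m. 0)"
    unfolding hpart_def by (rule sum.cong) (auto simp: Suc power_0_left)
  then show ?thesis using Suc by simp
qed simp

lemma zser_0: "zser c 0 = c 0 0"
proof -
  have "zser c 0 = (\<Sum>m\<in>{0}. hpart c m 0 0)"
    unfolding zser_def complex_cnj_zero by (rule suminf_finite) (auto simp: hpart_at_0)
  then show ?thesis by simp
qed

lemma hpart_euler:
  "of_nat (Suc m) * hpart c (Suc m) z w = z * hpart (Dz c) m z w + w * hpart (Dw c) m z w"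
proof -
  let ?t = "\<lambda>k. c k (Suc m - k) * z ^ k * w ^ (Suc m - k)"
  have A: "z * hpart (Dz c) m z w = (\<Sum>k\<le>Suc m. of_nat k * ?t k)"
    unfolding sum.atMost_Suc_shift hpart_def Dz_def sum_distrib_left
    by (simp add: mult_ac del: of_nat_Suc)
  have B: "w * hpart (Dw c) m z w = (\<Sum>k\<le>Suc m. of_nat (Suc m - k) * ?t k)"
    unfolding hpart_def Dw_def sum_distrib_left
    by (simp add: Suc_diff_le mult_ac del: of_nat_Suc of_nat_diff cong: sum.cong_simp)
  show ?thesis unfolding A B sum.distrib[symmetric] distrib_right[symmetric] of_nat_add[symmetric]
    unfolding hpart_def sum_distrib_left by (intro sum.cong) auto
qed

lemma Dx_Dy_commute: "Dx (Dy c) = Dy (Dx c)"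
  unfolding Dx_def Dy_def Dz_def Dw_def by (intro ext) (simp add: algebra_simps)

definition taylor_coeff :: "(nat \<Rightarrow> nat \<Rightarrow> complex) \<Rightarrow> nat \<Rightarrow> nat \<Rightarrow> complex" where
  "taylor_coeff c = (\<lambda>k l. (Dx ^^ k) ((Dy ^^ l) c) 0 0 / (fact k * fact l))"

lemma Dy_funpow_Dx_commute: "(Dy ^^ k) (Dx c) = Dx ((Dy ^^ k) c)"
  by (induction k) (simp_all add: Dx_Dy_commute)

text \<open>Read as coefficients of a series in x and y, \<open>taylor_coeff c\<close> turns the
  derivative in x into the index shift \<open>Dz\<close>; this makes \<open>hpart_euler\<close>
  applicable in both coordinate systems.\<close>

lemma taylor_coeff_Dx: "taylor_coeff (Dx c) = Dz (taylor_coeff c)"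
proof (intro ext)
  fix k l
  have "(Dx ^^ k) ((Dy ^^ l) (Dx c)) = (Dx ^^ Suc k) ((Dy ^^ l) c)"
    by (simp add: Dy_funpow_Dx_commute funpow_swap1)
  then show "taylor_coeff (Dx c) k l = Dz (taylor_coeff c) k l"
    unfolding taylor_coeff_def Dz_def by (simp add: field_simps del: funpow.simps of_nat_Suc)
qed

lemma taylor_coeff_Dy: "taylor_coeff (Dy c) = Dw (taylor_coeff c)"
proof (intro ext)
  fix k l
  have "(Dx ^^ k) ((Dy ^^ l) (Dy c)) = (Dx ^^ k) ((Dy ^^ Suc l) c)"
    by (simp add: funpow_swap1)
  then show "taylor_coeff (Dy c) k l = Dw (taylor_coeff c) k l"
    unfolding taylor_coeff_def Dw_def by (simp add: field_simps del: funpow.simps of_nat_Suc)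
qed

text \<open>Both sides satisfy Euler's identity for homogeneous polynomials, which determines them by
  induction on the degree.\<close>

lemma hpart_taylor_coeff:
  "hpart (taylor_coeff c) m (of_real x) (of_real y) = hpart c m (Complex x y) (cnj (Complex x y))"
proof (induction m arbitrary: c)
  case 0
  show ?case by (simp add: taylor_coeff_def)
next
  case (Suc m)
  let ?z = "Complex x y"
  have zx: "?z = of_real x + \<i> * of_real y" "cnj ?z = of_real x - \<i> * of_real y"
    by (simp_all add: complex_eq_iff)
  \<comment> \<open>The induction hypothesis is used for \<open>Dx c\<close> and
    \<open>Dy c\<close>, hence the arbitrary \<open>c\<close>.\<close>
  have "of_nat (Suc m) * hpart (taylor_coeff c) (Suc m) (of_real x) (of_real y)
      = of_real x * hpart (Dx c) m ?z (cnj ?z) + of_real y * hpart (Dy c) m ?z (cnj ?z)"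
    unfolding hpart_euler taylor_coeff_Dx[symmetric] taylor_coeff_Dy[symmetric] Suc.IH ..
  also have "\<dots> = ?z * hpart (Dz c) m ?z (cnj ?z) + cnj ?z * hpart (Dw c) m ?z (cnj ?z)"
    unfolding Dx_def Dy_def hpart_lincomb unfolding zx by (simp add: algebra_simps)
  also have "\<dots> = of_nat (Suc m) * hpart c (Suc m) ?z (cnj ?z)"
    unfolding hpart_euler ..
  finally show ?case by (simp del: of_nat_Suc)
qed

lemma zrep_homTaylor:
  assumes "zrep R F c" "R > 0"
  shows "homTaylor F m z = hpart c m (Complex (fst z) (snd z)) (cnj (Complex (fst z) (snd z)))"
proof -
  obtain x y where z: "z = (x, y)" by (cases z)
  have 0: "(0, 0) \<in> Bdisc R" using assms(2) by (simp add: in_Bdisc_iff Complex_eq zero_ereal_def)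
  have "pdw (replicate k True @ replicate l False) F (0, 0) = (Dx ^^ k) ((Dy ^^ l) c) 0 0" for k l
    using zrep_pdw_replicate[OF assms(1), of k l] 0 zser_0
    by (auto simp: zrep_def Complex_eq)
  then have "homTaylor F m z = hpart (taylor_coeff c) m (of_real x) (of_real y)"
    unfolding homTaylor_def hpart_def taylor_coeff_def z by (auto intro!: sum.cong)
  then show ?thesis by (simp add: hpart_taylor_coeff z)
qed

lemma compact_subset_Bdisc:
  assumes "compact K" "K \<subseteq> Bdisc R" "R > 0"
  obtains r where "0 \<le> r" "ereal r < R" "\<And>z. z \<in> K \<Longrightarrow> norm (Complex (fst z) (snd z)) \<le> r"
proof (cases "K = {}")
  case True
  then show ?thesis using that[of 0] assms(3) by (simp add: zero_ereal_def)
next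
  case False
  have "continuous_on K (\<lambda>z. norm (Complex (fst z) (snd z)))"
    unfolding Complex_eq by (intro continuous_intros)
  then obtain w where w: "w \<in> K" "\<forall>z\<in>K. norm (Complex (fst z) (snd z)) \<le> norm (Complex (fst w) (snd w))"
    using continuous_attains_sup[OF assms(1) False] by blast
  then show ?thesis using that[of "norm (Complex (fst w) (snd w))"] assms(2) by (auto simp: in_Bdisc_iff)
qed

lemma zrep_in_AB:
  assumes "zrep R F c" "R > 0"
  shows "F \<in> AB R"
  unfolding AB_def
proof (intro CollectI conjI allI impI)
  show "smooth_on (Bdisc R) F" using assms(1) by (rule zrep_smooth_on)
  have c: "geom_bdd R c" using assms by (simp add: zrep_def)
  fix K assume "compact K \<and> K \<subseteq> Bdisc R"
  then have K: "compact K" "K \<subseteq> Bdisc R" by auto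
  obtain r where r: "0 \<le> r" "ereal r < R" "\<And>z. z \<in> K \<Longrightarrow> norm (Complex (fst z) (snd z)) \<le> r"
    using compact_subset_Bdisc[OF K assms(2)] by blast
  obtain M where M: "summable M"
    "\<And>m z w. norm z \<le> r \<Longrightarrow> norm w \<le> r \<Longrightarrow> norm (hpart c m z w) \<le> M m"
    using hpart_bound[OF c r(1,2)] by blast
  have b: "norm (homTaylor F m z) \<le> M m" if "z \<in> K" for m z
    unfolding zrep_homTaylor[OF assms] using M(2) r(3)[OF that] by simp
  have "uniform_limit K (\<lambda>n z. \<Sum>m<n. homTaylor F m z) (\<lambda>z. \<Sum>m. homTaylor F m z) sequentially"
    by (rule Weierstrass_m_test[OF _ M(1)]) (use b in auto)
  moreover have "(\<Sum>m. homTaylor F m z) = F z" if "z \<in> K" for z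
    unfolding zrep_homTaylor[OF assms] zser_def[symmetric] using assms(1) K(2) that by (auto simp: zrep_def)
  ultimately show "uniform_limit K (\<lambda>n z. \<Sum>m<n. homTaylor F m z) F sequentially"
    by (simp cong: uniform_limit_cong')
  have "uniform_limit K (\<lambda>n z. \<Sum>m<n. norm (homTaylor F m z)) (\<lambda>z. \<Sum>m. norm (homTaylor F m z)) sequentially"
    by (rule Weierstrass_m_test[OF _ M(1)]) (use b in auto)
  then show "\<exists>h. uniform_limit K (\<lambda>n z. \<Sum>m<n. norm (homTaylor F m z)) h sequentially" by blast
qed

lemma zrep_zser: "geom_bdd R c \<Longrightarrow> zrep R (\<lambda>z. zser c (Complex (fst z) (snd z))) c"
  by (simp add: zrep_def)

text \<open>The pure second derivatives in z and in w cancel between the two summands; the mixed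
  ones add up with factor 4.\<close>

lemma zrep_lap: "zrep R F c \<Longrightarrow> zrep R (lap F) (\<lambda>k l. 4 * (of_nat (Suc k) * of_nat (Suc l) * c (Suc k) (Suc l)))"
proof -
  assume F: "zrep R F c"
  have "zrep R (\<lambda>z. 1 * dx (dx F) z + 1 * dy (dy F) z) (\<lambda>k l. 1 * Dx (Dx c) k l + 1 * Dy (Dy c) k l)"
    by (intro zrep_lincomb zrep_dx zrep_dy F)
  moreover have "(\<lambda>k l. 1 * Dx (Dx c) k l + 1 * Dy (Dy c) k l) = (\<lambda>k l. 4 * (of_nat (Suc k) * of_nat (Suc l) * c (Suc k) (Suc l)))"
    unfolding Dx_def Dy_def Dz_def Dw_def by (intro ext) (simp add: algebra_simps)
  ultimately show ?thesis by (simp add: lap_def)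
qed

text \<open>The factorial quotients come from differentiating \<open>p\<close> times in each
  variable. They never vanish, so the coefficients they multiply can be solved for.\<close>

lemma zrep_lap_funpow:
  assumes "zrep R F c"
  shows "zrep R ((lap ^^ p) F)
    (\<lambda>k l. 4 ^ p * (fact (k + p) / fact k) * (fact (l + p) / fact l) * c (k + p) (l + p))"
proof (induction p)
  case 0 show ?case using assms by simp
next
  case (Suc p)
  have "(\<lambda>k l. 4 * (of_nat (Suc k) * of_nat (Suc l) * (4 ^ p * (fact (Suc k + p) / fact (Suc k)) * (fact (Suc l + p) / fact (Suc l)) * c (Suc k + p) (Suc l + p))))
     = (\<lambda>k l. 4 ^ Suc p * (fact (k + Suc p) / fact k) * (fact (l + Suc p) / fact l) * c (k + Suc p) (l + Suc p))"
    by (intro ext) (simp add: field_simps del: of_nat_Suc)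
  then show ?case using zrep_lap[OF Suc.IH] by simp
qed

section \<open>Power series representation of the functions in \<open>A(B\<^sub>R)\<close>\<close>

text \<open>Discrete orthogonality of characters, in place of an integral over the circle. Exponents
  below \<open>n\<close> differ by less than \<open>n\<close>, so distinct ones stay distinct modulo
  \<open>n\<close>.\<close>

lemma sum_root_of_unity_powers:
  fixes i k n :: nat
  assumes "i < n" "k < n"
  shows "(\<Sum>j<n. cis (2 * pi * real j / real n) ^ i * cnj (cis (2 * pi * real j / real n)) ^ k)
    = (if i = k then of_nat n else 0)"
proof -
  define q where "q = cis (2 * pi * (real i - real k) / real n)"
  have n: "n > 0" using assms by simp
  have eq: "cis (2 * pi * real j / real n) ^ i * cnj (cis (2 * pi * real j / real n)) ^ k = q ^ j" for j
    unfolding q_def cis_cnj Complex.DeMoivre cis_mult by (simp add: field_simps diff_divide_distrib)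
  show ?thesis
  proof (cases "i = k")
    case True then show ?thesis unfolding eq by (simp add: q_def)
  next
    case False
    have "q \<noteq> 1"
    proof
      assume "q = 1"
      then obtain m :: int where "2 * pi * (real i - real k) / real n = of_int m * 2 * pi"
        unfolding q_def cis_conv_exp exp_eq_1 by auto
      then have "2 * pi * (real i - real k) = 2 * pi * (of_int m * real n)" using n by (simp add: field_simps)
      then have "real i - real k = of_int m * real n" by simp
      then have m: "int i - int k = m * int n"
        by (metis of_int_diff of_int_eq_iff of_int_mult of_int_of_nat_eq)
      then have "int n dvd (int i - int k)" by simp
      moreover have "\<bar>int i - int k\<bar> < int n" using assms by linarith
      ultimately have "int i - int k = 0" by (metis dvd_imp_le_int abs_of_nat linorder_not_less)
      then show False using False by simp
    qed
    moreover have "q ^ n = 1"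
    proof -
      have "q ^ n = cis (2 * pi * of_int (int i - int k))"
        unfolding q_def Complex.DeMoivre using n by simp
      also have "\<dots> = 1" by (rule cis_multiple_2pi) simp
      finally show ?thesis .
    qed
    ultimately have "(\<Sum>j<n. q ^ j) = 0" by (simp add: geometric_sum)
    then show ?thesis unfolding eq using False by simp
  qed
qed

lemma poly_coeff_bound_unit_circle:
  fixes e :: "nat \<Rightarrow> complex"
  assumes "\<And>\<zeta>. norm \<zeta> = 1 \<Longrightarrow> norm (\<Sum>i\<le>m. e i * \<zeta> ^ i) \<le> B" and "k \<le> m"
  shows "norm (e k) \<le> B"
proof -
  \<comment> \<open>One more sample point than the degree, so that averaging against
    \<open>cnj (w j) ^ k\<close> isolates \<open>e k\<close>.\<close>
  define n where "n = Suc m"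
  define w where "w j = cis (2 * pi * real j / real n)" for j :: nat
  have "(\<Sum>j<n. (\<Sum>i\<le>m. e i * w j ^ i) * cnj (w j) ^ k)
      = (\<Sum>i\<le>m. e i * (\<Sum>j<n. w j ^ i * cnj (w j) ^ k))"
    unfolding sum_distrib_right sum_distrib_left by (subst sum.swap) (simp add: mult.assoc)
  also have "\<dots> = (\<Sum>i\<le>m. if i = k then e i * of_nat n else 0)"
    unfolding w_def using assms(2) by (intro sum.cong refl, subst sum_root_of_unity_powers) (auto simp: n_def)
  also have "\<dots> = e k * of_nat n" using assms(2) by simp
  finally have "norm (e k * of_nat n) = norm (\<Sum>j<n. (\<Sum>i\<le>m. e i * w j ^ i) * cnj (w j) ^ k)" by simp
  also have "\<dots> \<le> (\<Sum>j<n. B)"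
    by (rule sum_norm_le) (use assms(1) in \<open>simp add: norm_mult norm_power w_def\<close>)
  also have "\<dots> = B * real n" by simp
  finally have "norm (e k) * real n \<le> B * real n" by (simp add: norm_mult)
  moreover have "real n > 0" by (simp add: n_def)
  ultimately show ?thesis by (rule mult_right_le_imp_le)
qed

lemma hpart_coeff_bound:
  assumes "r > 0" "\<And>z. norm z = r \<Longrightarrow> norm (hpart c m z (cnj z)) \<le> B" "k \<le> m"
  shows "norm (c k (m - k)) * r ^ m \<le> B"
proof -
  have "norm (c k (m - k)) \<le> B / r ^ m"
  proof (rule poly_coeff_bound_unit_circle[where e = "\<lambda>k. c k (m - k)" and m = m])
    fix \<zeta> :: complex assume \<zeta>: "norm \<zeta> = 1"
    \<comment> \<open>With a square root of \<open>\<zeta>\<close>,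
      \<open>s ^ i * cnj s ^ (m - i)\<close> equals \<open>cnj s ^ m * \<zeta> ^ i\<close>: up to a
      unimodular factor and \<open>r ^ m\<close> the homogeneous part is a polynomial in
      \<open>\<zeta>\<close> on the unit circle.\<close>
    define s where "s = csqrt \<zeta>"
    have s2: "s ^ 2 = \<zeta>" by (simp add: s_def)
    have ns: "norm s = 1" using \<zeta> unfolding s_def by (simp add: norm_csqrt)
    have ss: "s * cnj s = 1" using ns by (metis complex_norm_square one_power2 of_real_1)
    have "hpart c m (r * s) (cnj (r * s)) = (r ^ m * cnj s ^ m) * (\<Sum>i\<le>m. c i (m - i) * \<zeta> ^ i)"
      unfolding hpart_def sum_distrib_left
    proof (rule sum.cong)
      fix i assume i: "i \<in> {..m}"
      have "s ^ i * cnj s ^ (m - i) = cnj s ^ m * \<zeta> ^ i"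
      proof -
        have "cnj s ^ m * \<zeta> ^ i = cnj s ^ (m - i) * cnj s ^ i * (s ^ i * s ^ i)"
          using i by (simp add: s2[symmetric] power2_eq_square power_mult_distrib flip: power_add)
        also have "\<dots> = cnj s ^ (m - i) * s ^ i * (s * cnj s) ^ i"
          by (simp add: power_mult_distrib)
        finally show ?thesis unfolding ss by simp
      qed
      moreover have "complex_of_real r ^ m = of_real r ^ i * of_real r ^ (m - i)"
        using i by (simp flip: power_add)
      ultimately show "c i (m - i) * (complex_of_real r * s) ^ i * cnj (complex_of_real r * s) ^ (m - i)
         = complex_of_real (r ^ m) * cnj s ^ m * (c i (m - i) * \<zeta> ^ i)"
        by (simp add: power_mult_distrib mult_ac)
    qed simp
    moreover have "norm (hpart c m (r * s) (cnj (r * s))) \<le> B"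
      by (rule assms(2)) (use assms(1) ns in \<open>simp add: norm_mult\<close>)
    ultimately have "r ^ m * norm (\<Sum>i\<le>m. c i (m - i) * \<zeta> ^ i) \<le> B"
      using assms(1) ns by (simp add: norm_mult norm_power)
    then show "norm (\<Sum>i\<le>m. c i (m - i) * \<zeta> ^ i) \<le> B / r ^ m"
      using assms(1) by (simp add: field_simps)
  qed (use assms in auto)
  then show ?thesis using assms(1) by (simp add: field_simps)
qed

text \<open>The coefficients stay existential: a member of \<open>AB R\<close> is not yet known to
  have a double series, so its Taylor polynomials must be rewritten by algebra alone.\<close>

definition zhomog :: "nat \<Rightarrow> (complex \<Rightarrow> complex) \<Rightarrow> bool" where
  "zhomog m \<phi> \<longleftrightarrow> (\<exists>d. \<forall>z. \<phi> z = hpart d m z (cnj z))"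

lemma zhomog_lincomb:
  assumes "zhomog m \<phi>" "zhomog m \<psi>"
  shows "zhomog m (\<lambda>z. a * \<phi> z + b * \<psi> z)"
proof -
  obtain d e where "\<forall>z. \<phi> z = hpart d m z (cnj z)" "\<forall>z. \<psi> z = hpart e m z (cnj z)"
    using assms unfolding zhomog_def by blast
  then have "\<forall>z. a * \<phi> z + b * \<psi> z = hpart (\<lambda>k l. a * d k l + b * e k l) m z (cnj z)"
    by (simp add: hpart_lincomb)
  then show ?thesis unfolding zhomog_def by (intro exI)
qed

lemma hpart_mult_z: "hpart (\<lambda>k l. case k of 0 \<Rightarrow> 0 | Suc k \<Rightarrow> c k l) (Suc m) z w = z * hpart c m z w"
  unfolding hpart_def sum.atMost_Suc_shift sum_distrib_left by (simp add: mult_ac)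

lemma hpart_mult_w: "hpart (\<lambda>k l. case l of 0 \<Rightarrow> 0 | Suc l \<Rightarrow> c k l) (Suc m) z w = w * hpart c m z w"
  unfolding hpart_def sum_distrib_left by (simp add: Suc_diff_le mult_ac)

lemma zhomog_mult_z: "zhomog m \<phi> \<Longrightarrow> zhomog (Suc m) (\<lambda>z. z * \<phi> z)"
  unfolding zhomog_def by (metis hpart_mult_z)

lemma zhomog_mult_cnj: "zhomog m \<phi> \<Longrightarrow> zhomog (Suc m) (\<lambda>z. cnj z * \<phi> z)"
  unfolding zhomog_def by (metis hpart_mult_w)

lemma zhomog_mult_Re:
  assumes "zhomog m \<phi>"
  shows "zhomog (Suc m) (\<lambda>z. of_real (Re z) * \<phi> z)"
proof -
  have "(\<lambda>z. of_real (Re z) * \<phi> z) = (\<lambda>z. (1 / 2) * (z * \<phi> z) + (1 / 2) * (cnj z * \<phi> z))"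
    by (intro ext) (simp add: complex_eq_iff field_simps)
  then show ?thesis
    using zhomog_lincomb[OF zhomog_mult_z[OF assms] zhomog_mult_cnj[OF assms], of "1/2" "1/2"] by simp
qed

lemma zhomog_mult_Im:
  assumes "zhomog m \<phi>"
  shows "zhomog (Suc m) (\<lambda>z. of_real (Im z) * \<phi> z)"
proof -
  have "(\<lambda>z. of_real (Im z) * \<phi> z) = (\<lambda>z. (- \<i> / 2) * (z * \<phi> z) + (\<i> / 2) * (cnj z * \<phi> z))"
    by (intro ext) (simp add: complex_eq_iff field_simps)
  then show ?thesis
    using zhomog_lincomb[OF zhomog_mult_z[OF assms] zhomog_mult_cnj[OF assms], of "- \<i> / 2" "\<i> / 2"] by simp
qed

lemma zhomog_0: "zhomog m (\<lambda>z. 0)"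
  unfolding zhomog_def hpart_def by (rule exI[of _ "\<lambda>k l. 0"]) simp

lemma zhomog_monomial: "zhomog (k + l) (\<lambda>z. of_real (Re z) ^ k * of_real (Im z) ^ l)"
proof (induction k)
  case 0
  show ?case
  proof (induction l)
    case 0
    have "\<forall>z. 1 = hpart (\<lambda>k l. 1) 0 z (cnj z)" by simp
    then show ?case unfolding zhomog_def by (intro exI[of _ "\<lambda>k l. 1"]) simp
  next
    case (Suc l) then show ?case using zhomog_mult_Im[OF Suc] by (simp add: mult_ac)
  qed
next
  case (Suc k) then show ?case using zhomog_mult_Re[OF Suc] by (simp add: mult_ac)
qed

lemma zhomog_sum:
  assumes "finite A" "\<And>i. i \<in> A \<Longrightarrow> zhomog m (\<phi> i)"
  shows "zhomog m (\<lambda>z. \<Sum>i\<in>A. \<phi> i z)"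
  using assms
proof (induction A rule: finite_induct)
  case empty show ?case by (simp add: zhomog_0)
next
  case (insert i A)
  then show ?case using zhomog_lincomb[of m "\<phi> i" "\<lambda>z. \<Sum>i\<in>A. \<phi> i z" 1 1] by simp
qed

lemma homTaylor_hpart_ex:
  "\<exists>d. \<forall>z. homTaylor F m z = hpart d m (Complex (fst z) (snd z)) (cnj (Complex (fst z) (snd z)))"
proof -
  let ?e = "\<lambda>k. of_real (1 / (fact k * fact (m - k))) * pdw (replicate k True @ replicate (m - k) False) F (0,0)"
  have "zhomog m (\<lambda>z. \<Sum>k\<le>m. ?e k * (of_real (Re z) ^ k * of_real (Im z) ^ (m - k)))"
  proof (rule zhomog_sum)
    fix k assume "k \<in> {..m}"
    then have "zhomog m (\<lambda>z. of_real (Re z) ^ k * of_real (Im z) ^ (m - k))"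
      using zhomog_monomial[of k "m - k"] by simp
    from zhomog_lincomb[OF this this, of "?e k" 0]
    show "zhomog m (\<lambda>z. ?e k * (of_real (Re z) ^ k * of_real (Im z) ^ (m - k)))" by simp
  qed simp
  then obtain d where d: "\<And>z. (\<Sum>k\<le>m. ?e k * (of_real (Re z) ^ k * of_real (Im z) ^ (m - k))) = hpart d m z (cnj z)"
    unfolding zhomog_def by blast
  have "homTaylor F m (x, y) = hpart d m (Complex x y) (cnj (Complex x y))" for x y
    unfolding d[symmetric] homTaylor_def by simp
  then show ?thesis by (intro exI[of _ d]) auto
qed

text \<open>Converse of \<open>zrep_in_AB\<close>: uniform convergence of the series of absolute
  values bounds the homogeneous parts on circles, and \<open>hpart_coeff_bound\<close> passes this
  on to the coefficients.\<close>

lemma AB_imp_zrep: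
  assumes "F \<in> AB R"
  obtains c where "zrep R F c"
proof -
  obtain d where d: "\<And>m z. homTaylor F m z = hpart (d m) m (Complex (fst z) (snd z)) (cnj (Complex (fst z) (snd z)))"
    using homTaylor_hpart_ex by metis
  \<comment> \<open>\<open>hpart (d m) m\<close> reads only entries with \<open>k + l = m\<close>,
    so the families for different degrees glue together.\<close>
  define c where "c k l = d (k + l) k l" for k l
  have dc: "hpart (d m) m z w = hpart c m z w" for m z w
    unfolding hpart_def c_def by (intro sum.cong) auto
  note H = d[unfolded dc]
  have ul: "uniform_limit K (\<lambda>n z. \<Sum>m<n. homTaylor F m z) F sequentially"
    "\<exists>h. uniform_limit K (\<lambda>n z. \<Sum>m<n. norm (homTaylor F m z)) h sequentially"
    if "compact K" "K \<subseteq> Bdisc R" for K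
    using assms that unfolding AB_def by auto
  have "geom_bdd R c" unfolding geom_bdd_def
  proof (intro allI impI)
    fix r :: real assume r: "r > 0" "ereal r < R"
    define K where "K = (\<lambda>z. (Re z, Im z)) ` sphere 0 r"
    have "continuous_on (sphere 0 r) (\<lambda>z. (Re z, Im z))" by (intro continuous_intros)
    then have K1: "compact K" unfolding K_def by (rule compact_continuous_image) simp
    have K2: "K \<subseteq> Bdisc R" using r by (auto simp: K_def in_Bdisc_iff)
    obtain h where h: "uniform_limit K (\<lambda>n z. \<Sum>m<n. norm (homTaylor F m z)) h sequentially"
      using ul(2)[OF K1 K2] by blast
    have "\<forall>\<^sub>F n in sequentially. \<forall>z\<in>K. dist (\<Sum>m<n. norm (homTaylor F m z)) (h z) < 1"
      by (rule uniform_limitD[OF h]) simp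
    then obtain N where N: "\<And>n z. n \<ge> N \<Longrightarrow> z \<in> K \<Longrightarrow> dist (\<Sum>m<n. norm (homTaylor F m z)) (h z) < 1"
      unfolding eventually_sequentially by blast
    \<comment> \<open>Two consecutive partial sums both lie within 1 of \<open>h\<close>, so the
      term between them is at most 2.\<close>
    have big: "norm (c k l) * r ^ (k + l) \<le> 2" if "k + l \<ge> N" for k l
    proof -
      have "norm (c k (k + l - k)) * r ^ (k + l) \<le> 2"
      proof (rule hpart_coeff_bound[OF r(1)])
        fix z :: complex assume z: "norm z = r"
        then have zK: "(Re z, Im z) \<in> K" by (auto simp: K_def)
        have "dist (\<Sum>m<k + l. norm (homTaylor F m (Re z, Im z))) (h (Re z, Im z)) < 1"
          "dist (\<Sum>m<Suc (k + l). norm (homTaylor F m (Re z, Im z))) (h (Re z, Im z)) < 1"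
          using N[OF _ zK] that by (metis le_SucI)+
        then have "norm (homTaylor F (k + l) (Re z, Im z)) \<le> 2"
          by (auto simp: dist_real_def)
        then show "norm (hpart c (k + l) z (cnj z)) \<le> 2" by (simp add: H)
      qed simp
      then show ?thesis by simp
    qed
    \<comment> \<open>The finitely many pairs with \<open>k + l < N\<close> all lie in this
      square.\<close>
    let ?S = "(\<lambda>(k, l). norm (c k l) * r ^ (k + l)) ` ({..N} \<times> {..N})"
    have fin: "finite ?S" by simp
    have "norm (c k l) * r ^ (k + l) \<le> max 2 (Max ?S)" for k l
    proof (cases "k + l \<ge> N")
      case True then show ?thesis using big by (simp add: le_max_iff_disj)
    next
      case False
      then have "norm (c k l) * r ^ (k + l) \<in> ?S" by (intro image_eqI[of _ _ "(k, l)"]) auto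
      then have "norm (c k l) * r ^ (k + l) \<le> Max ?S" using fin by (rule Max_ge[rotated])
      then show ?thesis by simp
    qed
    then show "\<exists>C. \<forall>k l. norm (c k l) * r ^ (k + l) \<le> C" by blast
  qed
  moreover have "F z = zser c (Complex (fst z) (snd z))" if "z \<in> Bdisc R" for z
  proof -
    have "uniform_limit {z} (\<lambda>n z. \<Sum>m<n. homTaylor F m z) F sequentially"
      using that by (intro ul) auto
    then have "(\<lambda>n. \<Sum>m<n. homTaylor F m z) \<longlonglongrightarrow> F z"
      by (rule tendsto_uniform_limitI) simp
    then have "(\<lambda>m. homTaylor F m z) sums F z" by (simp add: sums_def)
    then show ?thesis unfolding H zser_def by (simp add: sums_iff)
  qed
  ultimately show ?thesis using that[of c] by (simp add: zrep_def)
qed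

section \<open>Identity theorem along lines through the origin\<close>

lemma hpart_scale:
  "hpart c m (t * z) (t * w) = hpart c m z w * t ^ m"
  unfolding hpart_def sum_distrib_right
proof (rule sum.cong)
  fix k assume "k \<in> {..m}"
  then have "t ^ m = t ^ k * t ^ (m - k)" by (simp flip: power_add)
  then show "c k (m - k) * (t * z) ^ k * (t * w) ^ (m - k) = c k (m - k) * z ^ k * w ^ (m - k) * t ^ m"
    by (simp add: power_mult_distrib mult_ac)
qed simp

text \<open>Along the line the homogeneous parts are the coefficients of a power series in the
  parameter, and zeros at all small real parameters contradict the isolation of zeros.\<close>

lemma hpart_eq_0_if_zser_eq_0_on_line:
  assumes c: "geom_bdd R c" and "R > 0" "\<epsilon> > 0"
    and zero: "\<And>t. 0 \<le> t \<Longrightarrow> t < \<epsilon> \<Longrightarrow> zser c (of_real t * d) = 0"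
  shows "hpart c m d (cnj d) = 0"
proof (rule ccontr)
  assume m: "hpart c m d (cnj d) \<noteq> 0"
  obtain s where s: "s > 0" "ereal s < R"
    using ereal_between_real[of 0 R] \<open>R > 0\<close> by (auto simp: zero_ereal_def)
  define r where "r = s / (norm d + 1)"
  have r: "r > 0" unfolding r_def using s by (simp add: add_nonneg_pos)
  \<comment> \<open>For complex \<open>t\<close> this sums \<open>hpart\<close> at the pair
    \<open>(t * d, t * cnj d)\<close>, in general not a conjugate pair; \<open>f\<close> is
    identified with \<open>zser\<close> at real \<open>t\<close> only. The radius \<open>r\<close>
    keeps both entries in the disc.\<close>
  define f where "f t = (\<Sum>n. hpart c n d (cnj d) * t ^ n)" for t
  have sm: "(\<lambda>n. hpart c n d (cnj d) * (t - 0) ^ n) sums f t" if "norm (t - 0) < r" for t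
  proof -
    have "norm (t * d) \<le> r * (norm d + 1)"
      using that r unfolding norm_mult by (intro mult_mono) auto
    also have "\<dots> = s" unfolding r_def by (simp add: add_nonneg_eq_0_iff)
    finally have "ereal (norm (t * d)) \<le> ereal s" by simp
    then have "ereal (norm (t * d)) < R" using s(2) by (rule order_le_less_trans)
    then have n: "ereal (norm (t * d)) < R" "ereal (norm (t * cnj d)) < R"
      by (simp_all add: norm_mult)
    show ?thesis unfolding f_def diff_zero hpart_scale[symmetric]
      by (rule summable_sums[OF summable_hpart[OF c n]])
  qed
  have f: "f (of_real t) = zser c (of_real t * d)" for t :: real
    unfolding f_def zser_def by (simp add: hpart_scale)
  have f0: "f 0 = 0" using f[of 0] zero[of 0] \<open>\<epsilon> > 0\<close> by simp
  have "hpart c 0 d (cnj d) = 0" using f0 f[of 0] by (simp add: zser_0)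
  then have "m > 0" using m by (cases m) auto
  then obtain e where e: "e > 0" "\<And>t. t \<in> cball 0 e - {0} \<Longrightarrow> f t \<noteq> 0"
    using powser_0_nonzero[OF r sm f0 m] by blast
  define t where "t = min e (\<epsilon> / 2)"
  have t: "0 < t" "t \<le> e" "t < \<epsilon>" using e(1) \<open>\<epsilon> > 0\<close> by (auto simp: t_def)
  have "f (of_real t) \<noteq> 0" using t by (intro e(2)) auto
  then show False using f zero[of t] t by simp
qed

text \<open>All homogeneous parts of the difference vanish on the unit circle; the coefficient bound
  with \<open>B = 0\<close> finishes.\<close>

lemma zser_eq_imp_coeff_eq:
  assumes c: "geom_bdd R c" and d: "geom_bdd R d" and "R > 0"
    and eq: "\<And>z. ereal (norm z) < R \<Longrightarrow> zser c z = zser d z"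
  shows "c = d"
proof (intro ext)
  fix k l
  let ?e = "\<lambda>k l. 1 * c k l + (- 1) * d k l"
  have e: "geom_bdd R ?e" using c d by (rule geom_bdd_lincomb)
  obtain s where s: "s > 0" "ereal s < R"
    using ereal_between_real[of 0 R] \<open>R > 0\<close> by (auto simp: zero_ereal_def)
  have "hpart ?e (k + l) z (cnj z) = 0" if "norm z = 1" for z
  proof (rule hpart_eq_0_if_zser_eq_0_on_line[OF e \<open>R > 0\<close> s(1)])
    fix t assume "0 \<le> t" "t < s"
    then have "ereal (norm (of_real t * z)) \<le> ereal s" using that by (simp add: norm_mult)
    then have "ereal (norm (of_real t * z)) < R" using s(2) by (rule order_le_less_trans)
    then show "zser ?e (of_real t * z) = 0"
      using zser_lincomb[OF c d, of _ 1 "-1"] eq by simp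
  qed
  then have "norm (?e k (k + l - k)) * 1 ^ (k + l) \<le> 0"
    by (intro hpart_coeff_bound) auto
  then show "c k l = d k l" by simp
qed

section \<open>Division by linear forms\<close>

definition zmul :: "complex \<Rightarrow> (nat \<Rightarrow> nat \<Rightarrow> complex) \<Rightarrow> nat \<Rightarrow> nat \<Rightarrow> complex" where
  "zmul A b = (\<lambda>k l. 1 * (case k of 0 \<Rightarrow> 0 | Suc k \<Rightarrow> b k l) + (- A) * (case l of 0 \<Rightarrow> 0 | Suc l \<Rightarrow> b k l))"

lemma hpart_zmul: "hpart (zmul A b) (Suc m) z w = (z - A * w) * hpart b m z w"
  unfolding zmul_def hpart_lincomb hpart_mult_z hpart_mult_w by (simp add: algebra_simps)

text \<open>Horner's scheme for division by \<open>z - A * w\<close>: the recursion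
  \<open>q k l = c (Suc k) l + A * q (Suc k) (l - 1)\<close>, without its second term at
  \<open>l = 0\<close>, unrolled within one degree.\<close>

definition zquot :: "complex \<Rightarrow> (nat \<Rightarrow> nat \<Rightarrow> complex) \<Rightarrow> nat \<Rightarrow> nat \<Rightarrow> complex" where
  "zquot A c = (\<lambda>k l. \<Sum>j\<le>l. c (Suc (k + j)) (l - j) * A ^ j)"

text \<open>Entries with positive \<open>k\<close> match by the recursion alone; those with
  \<open>k = 0\<close> carry the remainder, which is \<open>hpart c N A 1\<close>.\<close>

lemma zmul_zquot:
  assumes "\<And>N. hpart c N A 1 = 0"
  shows "zmul A (zquot A c) = c"
proof (intro ext)
  fix k l
  show "zmul A (zquot A c) k l = c k l"
  proof (cases k; cases l)
    assume "k = 0" "l = 0"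
    then show ?thesis using assms[of 0] by (simp add: zmul_def)
  next
    fix l' assume kl: "k = 0" "l = Suc l'"
    have "0 = c 0 l + A * zquot A c 0 l'"
      using assms[of l] unfolding kl(2) hpart_def sum.atMost_Suc_shift zquot_def sum_distrib_left
      by (simp add: mult_ac)
    then show ?thesis using kl by (simp add: zmul_def add_eq_0_iff)
  next
    fix k' assume "k = Suc k'" "l = 0"
    then show ?thesis by (simp add: zmul_def zquot_def)
  next
    fix k' l' assume kl: "k = Suc k'" "l = Suc l'"
    have "zquot A c k' l = c k l + A * zquot A c k l'"
      unfolding kl zquot_def sum.atMost_Suc_shift sum_distrib_left by (simp add: mult_ac)
    then show ?thesis using kl by (simp add: zmul_def)
  qed
qed

text \<open>Since \<open>norm A = 1\<close>, the quotient is a sum of \<open>l + 1\<close> terms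
  with one common bound. This costs a linear factor, so division keeps the radius.\<close>

lemma geom_bdd_zquot:
  assumes "geom_bdd R c" "norm A = 1"
  shows "geom_bdd R (zquot A c)"
proof (rule geom_bddI)
  fix s :: real assume s: "s > 0" "ereal s < R"
  obtain C where C: "C \<ge> 0" "\<And>k l. norm (c k l) \<le> C / s ^ (k + l)" using geom_bddD[OF assms(1) s] by blast
  have "norm (zquot A c k l) \<le> (C / s) * real (Suc (k + l)) / s ^ (k + l)" for k l
  proof -
    have "norm (zquot A c k l) \<le> (\<Sum>j\<le>l. C / s ^ Suc (k + l))"
      unfolding zquot_def
    proof (rule sum_norm_le)
      fix j assume "j \<in> {..l}"
      then have "Suc (k + j) + (l - j) = Suc (k + l)" by simp
      then show "norm (c (Suc (k + j)) (l - j) * A ^ j) \<le> C / s ^ Suc (k + l)"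
        using C(2)[of "Suc (k + j)" "l - j"] assms(2) by (simp add: norm_mult norm_power)
    qed
    also have "\<dots> = real (Suc l) * (C / s ^ Suc (k + l))" by simp
    also have "\<dots> \<le> real (Suc (k + l)) * (C / s ^ Suc (k + l))"
      using C s by (intro mult_right_mono) auto
    also have "\<dots> = (C / s) * real (Suc (k + l)) / s ^ (k + l)" by simp
    finally show ?thesis .
  qed
  then show "\<exists>C. \<forall>k l. norm (zquot A c k l) \<le> C * real (Suc (k + l)) / s ^ (k + l)" by blast
qed

lemma zser_zmul:
  assumes "geom_bdd R b" "ereal (norm z) < R"
  shows "zser (zmul A b) z = (z - A * cnj z) * zser b z"
proof -
  have "(\<lambda>m. (z - A * cnj z) * hpart b m z (cnj z)) sums ((z - A * cnj z) * zser b z)"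
    using assms by (intro sums_mult zser_sums)
  then have "(\<lambda>m. hpart (zmul A b) (Suc m) z (cnj z)) sums ((z - A * cnj z) * zser b z)"
    unfolding hpart_zmul .
  then have "(\<lambda>m. hpart (zmul A b) m z (cnj z)) sums ((z - A * cnj z) * zser b z + hpart (zmul A b) 0 z (cnj z))"
    by (rule sums_Suc)
  then show ?thesis unfolding zser_def by (simp add: sums_iff zmul_def)
qed

lemma zser_divide:
  assumes "finite J" "inj_on A J" "\<And>i. i \<in> J \<Longrightarrow> norm (A i) = 1"
    and "geom_bdd R c" "\<And>i N. i \<in> J \<Longrightarrow> hpart c N (A i) 1 = 0"
  shows "\<exists>q. geom_bdd R q \<and> (\<forall>z. ereal (norm z) < R \<longrightarrow> zser c z = (\<Prod>i\<in>J. z - A i * cnj z) * zser q z)"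
  using assms
proof (induction J arbitrary: c rule: finite_induct)
  case empty
  then show ?case by auto
next
  case (insert j J)
  let ?b = "zquot (A j) c"
  have b: "geom_bdd R ?b" using insert.prems by (intro geom_bdd_zquot) auto
  have cb: "zmul (A j) ?b = c" using insert.prems by (intro zmul_zquot) auto
  \<comment> \<open>Dividing out node \<open>j\<close> preserves the zeros at the other nodes
    because the nodes are distinct.\<close>
  have "hpart ?b N (A i) 1 = 0" if "i \<in> J" for i N
  proof -
    have "(A i - A j) * hpart ?b N (A i) 1 = hpart c (Suc N) (A i) 1"
      using hpart_zmul[of "A j" ?b N "A i" 1] unfolding cb by simp
    moreover have "A i \<noteq> A j" using insert.prems(1) insert.hyps(2) that by (auto simp: inj_on_def)
    ultimately show ?thesis using insert.prems(4) that by simp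
  qed
  then obtain q where q: "geom_bdd R q"
    "\<forall>z. ereal (norm z) < R \<longrightarrow> zser ?b z = (\<Prod>i\<in>J. z - A i * cnj z) * zser q z"
    using insert.IH[OF _ _ b] insert.prems by (auto simp: inj_on_insert)
  have "zser c z = (\<Prod>i\<in>insert j J. z - A i * cnj z) * zser q z" if "ereal (norm z) < R" for z
    using zser_zmul[OF b that, of "A j"] q(2) that insert.hyps unfolding cb by simp
  then show ?case using q(1) by blast
qed

section \<open>Lines through the origin and divisibility by the polynomial\<close>

definition node :: "(nat \<Rightarrow> real) \<Rightarrow> nat \<Rightarrow> complex" where
  "node a i = (if i = 0 then 1 else Aof (a i))"

lemma Aof_denom_nonzero: "complex_of_real a - \<i> \<noteq> 0" "complex_of_real a + \<i> \<noteq> 0"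
  by (simp_all add: complex_eq_iff)

lemma norm_node: "norm (node a i) = 1"
proof -
  have "norm (complex_of_real b + \<i>) = norm (complex_of_real b - \<i>)" for b
    by (simp add: cmod_def)
  then show ?thesis using Aof_denom_nonzero by (simp add: node_def Aof_def norm_divide)
qed

text \<open>\<open>Aof\<close> is a Cayley transform: injective on the reals and never 1, the value
  that belongs to the line y = 0.\<close>

lemma inj_on_node:
  assumes "inj_on a {1..2*p-1}"
  shows "inj_on (node a) {..<2*p}"
proof (rule inj_onI)
  fix i j assume ij: "i \<in> {..<2*p}" "j \<in> {..<2*p}" "node a i = node a j"
  have A1: "Aof b \<noteq> 1" for b
  proof
    assume "Aof b = 1"
    then have "complex_of_real b + \<i> = complex_of_real b - \<i>"
      using Aof_denom_nonzero[of b] by (simp add: Aof_def)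
    then show False by (simp add: complex_eq_iff)
  qed
  have "b = b'" if "Aof b = Aof b'" for b b'
  proof -
    have "(complex_of_real b + \<i>) * (complex_of_real b' - \<i>) = (complex_of_real b' + \<i>) * (complex_of_real b - \<i>)"
      using that Aof_denom_nonzero by (simp add: Aof_def frac_eq_eq)
    then show ?thesis by (simp add: complex_eq_iff)
  qed
  then show "i = j"
    using ij A1 A1[symmetric] assms by (auto simp: node_def inj_on_def split: if_splits)
qed

text \<open>Multiplying \<open>z - Aof b * cnj z\<close> by \<open>b - \<i>\<close> gives -2i (x - b
  y), and z - cnj z is 2i y; \<open>K\<close> collects these constants.\<close>

lemma Ppoly_eq_prod_node:
  assumes "p > 0"
  obtains K where "K \<noteq> 0"
    "\<And>x y. Ppoly p a (x, y) = K * (\<Prod>i<2*p. Complex x y - node a i * cnj (Complex x y))"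
proof -
  define K where "K = (- \<i> / 2) * (\<Prod>j=1..2*p-1. (\<i> / 2) * (complex_of_real (a j) - \<i>))"
  have "K \<noteq> 0" using Aof_denom_nonzero by (auto simp: K_def)
  moreover have "Ppoly p a (x, y) = K * (\<Prod>i<2*p. Complex x y - node a i * cnj (Complex x y))" for x y
  proof -
    let ?z = "Complex x y"
    have z: "?z = of_real x + \<i> * of_real y" "cnj ?z = of_real x - \<i> * of_real y"
      by (simp_all add: complex_eq_iff)
    have lin: "of_real (x - b * y) = (\<i> / 2) * (complex_of_real b - \<i>) * (?z - Aof b * cnj ?z)" for b
      unfolding z Aof_def using Aof_denom_nonzero[of b] by (simp add: field_simps)
    have y: "of_real y = (- \<i> / 2) * (?z - node a 0 * cnj ?z)"
      unfolding z by (simp add: node_def field_simps)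
    have set: "{..<2*p} = insert 0 {1..2*p-1}" using assms by auto
    have "Ppoly p a (x, y) = of_real y * (\<Prod>j=1..2*p-1. of_real (x - a j * y))"
      by (simp add: Ppoly_def)
    also have "(\<Prod>j=1..2*p-1. complex_of_real (x - a j * y))
       = (\<Prod>j=1..2*p-1. (\<i> / 2) * (complex_of_real (a j) - \<i>)) * (\<Prod>j=1..2*p-1. ?z - node a j * cnj ?z)"
      unfolding prod.distrib[symmetric] lin by (intro prod.cong) (auto simp: node_def)
    finally show ?thesis
      unfolding y K_def set by (subst prod.insert) (simp_all add: mult_ac)
  qed
  ultimately show ?thesis using that by blast
qed

lemma zrep_mono:
  assumes "zrep R F c" "R' \<le> R"
  shows "zrep R' F c"
proof -
  have "z \<in> Bdisc R" if "z \<in> Bdisc R'" for z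
    using that assms(2) by (auto simp: in_Bdisc_iff)
  then show ?thesis using assms geom_bdd_mono unfolding zrep_def by blast
qed

lemma PdvdI:
  assumes "p > 0" "inj_on a {1..2*p-1}" "R > 0" "zrep R h c"
    and "\<And>i N. i < 2*p \<Longrightarrow> hpart c N (node a i) 1 = 0"
  shows "Pdvd p a h"
proof -
  obtain \<epsilon> where \<epsilon>: "\<epsilon> > 0" "ereal \<epsilon> < R"
    using ereal_between_real[of 0 R] \<open>R > 0\<close> by (auto simp: zero_ereal_def)
  have h: "zrep (ereal \<epsilon>) h c" using assms(4) \<epsilon>(2) by (rule zrep_mono[OF _ less_imp_le])
  have c: "geom_bdd (ereal \<epsilon>) c" using h by (simp add: zrep_def)
  obtain q where q: "geom_bdd (ereal \<epsilon>) q"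
    "\<And>z. ereal (norm z) < ereal \<epsilon> \<Longrightarrow> zser c z = (\<Prod>i<2*p. z - node a i * cnj z) * zser q z"
    using zser_divide[OF _ inj_on_node[OF assms(2)] norm_node c] assms(5) by auto
  obtain K where K: "K \<noteq> 0"
    "\<And>x y. Ppoly p a (x, y) = K * (\<Prod>i<2*p. Complex x y - node a i * cnj (Complex x y))"
    using Ppoly_eq_prod_node[OF assms(1)] by blast
  \<comment> \<open>The zero summand makes the scalar multiple an instance of
    \<open>zrep_lincomb\<close>.\<close>
  define Q where "Q = (\<lambda>z. (1 / K) * zser q (Complex (fst z) (snd z)) + 0 * zser q (Complex (fst z) (snd z)))"
  have "zrep (ereal \<epsilon>) Q (\<lambda>k l. (1 / K) * q k l + 0 * q k l)"
    unfolding Q_def by (intro zrep_lincomb zrep_zser q(1))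
  then have "Q \<in> AB (ereal \<epsilon>)" using \<epsilon> by (intro zrep_in_AB) auto
  moreover have "h z = Ppoly p a z * Q z" if "z \<in> Bdisc (ereal \<epsilon>)" for z
  proof -
    obtain x y where z: "z = (x, y)" by (cases z)
    have "h z = zser c (Complex x y)" using h that z by (simp add: zrep_def)
    then show ?thesis using q(2)[of "Complex x y"] that K by (simp add: in_Bdisc_iff z Q_def)
  qed
  ultimately show ?thesis unfolding Pdvd_def using \<epsilon>(1) by blast
qed

lemma PdvdD:
  assumes "Pdvd p a h" "R > 0" "zrep R h c" "i < 2*p"
  shows "hpart c N (node a i) 1 = 0"
proof -
  obtain \<epsilon> q where \<epsilon>: "\<epsilon> > 0" "\<And>z. z \<in> Bdisc (ereal \<epsilon>) \<Longrightarrow> h z = Ppoly p a z * q z"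
    using assms(1) unfolding Pdvd_def by blast
  obtain s where s: "s > 0" "ereal s < R"
    using ereal_between_real[of 0 R] \<open>R > 0\<close> by (auto simp: zero_ereal_def)
  \<comment> \<open>Direction of line \<open>i\<close> as a complex number: (a_i, 1), or (1, 0) for
    y = 0. As \<open>d = cnj d * node a i\<close>, homogeneity moves the evaluation from
    \<open>(d, cnj d)\<close> to \<open>(node a i, 1)\<close>.\<close>
  define d where "d = (if i = 0 then 1 else Complex (a i) 1)"
  have d: "cnj d \<noteq> 0" "d = cnj d * node a i"
    using Aof_denom_nonzero[of "a i"]
    by (auto simp: d_def node_def Aof_def Complex_eq)
  have c: "geom_bdd R c" using assms(3) by (simp add: zrep_def)
  define \<delta> where "\<delta> = min s \<epsilon> / norm d"
  have \<delta>: "\<delta> > 0" using s \<epsilon> d(1) by (simp add: \<delta>_def)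
  have "hpart c N d (cnj d) = 0"
  proof (rule hpart_eq_0_if_zser_eq_0_on_line[OF c \<open>R > 0\<close> \<delta>])
    fix t assume t: "0 \<le> t" "t < \<delta>"
    let ?z = "(t * Re d, t * Im d)"
    have C: "Complex (t * Re d) (t * Im d) = of_real t * d" by (simp add: complex_eq_iff)
    have "norm (of_real t * d) < min s \<epsilon>"
      using t d(1) by (simp add: norm_mult \<delta>_def pos_less_divide_eq del: min_less_iff_conj)
    then have n: "norm (of_real t * d) < s" "norm (of_real t * d) < \<epsilon>" by auto
    have "ereal (norm (of_real t * d)) < R" using n(1) s(2) by (metis less_ereal.simps(1) order.strict_trans)
    then have "zser c (of_real t * d) = h ?z"
      using assms(3) unfolding zrep_def by (simp add: in_Bdisc_iff C)
    also have "\<dots> = Ppoly p a ?z * q ?z"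
      by (rule \<epsilon>(2)) (use n in \<open>simp add: in_Bdisc_iff C\<close>)
    also have "Ppoly p a ?z = 0"
    proof (cases "i = 0")
      case True then show ?thesis by (simp add: Ppoly_def d_def)
    next
      case False
      then have "i \<in> {1..2*p-1}" "t * Re d - a i * (t * Im d) = 0" using assms(4) by (auto simp: d_def)
      then have "(\<Prod>j=1..2*p-1. t * Re d - a j * (t * Im d)) = 0"
        by (intro prod_zero bexI[of _ i]) auto
      then show ?thesis unfolding Ppoly_def split_conv by (simp only: mult_zero_right of_real_0)
    qed
    finally show "zser c (of_real t * d) = 0" by simp
  qed
  moreover have "hpart c N d (cnj d) = hpart c N (node a i) 1 * cnj d ^ N"
    using hpart_scale[of c N "cnj d" "node a i" 1] d(2) by simp
  ultimately show ?thesis using d(1) by simp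
qed

section \<open>Linear systems with bounded entries\<close>

lemma norm_det_le_fact:
  fixes A :: "complex mat"
  assumes A: "A \<in> carrier_mat n n" and le: "\<And>i j. i < n \<Longrightarrow> j < n \<Longrightarrow> norm (A $$ (i, j)) \<le> 1"
  shows "norm (Determinant.det A) \<le> fact n"
proof -
  have "norm (Determinant.det A) \<le> (\<Sum>q | q permutes {0..<n}. 1)"
    unfolding det_def'[OF A]
  proof (rule sum_norm_le)
    fix q assume "q \<in> {q. q permutes {0..<n}}"
    then have q: "q i < n" if "i < n" for i using that by (auto dest: permutes_in_image[of _ _ i])
    have "norm (signof q :: complex) = 1" by (auto simp: sign_def)
    moreover have "norm (\<Prod>i = 0..<n. A $$ (i, q i)) \<le> 1"
      unfolding prod_norm[symmetric] by (rule prod_le_1) (auto intro: le q)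
    ultimately show "norm (signof q * (\<Prod>i = 0..<n. A $$ (i, q i))) \<le> 1" by (simp add: norm_mult)
  qed
  also have "\<dots> = fact n" by (simp add: card_permutations)
  finally show ?thesis .
qed

lemma norm_adj_mat_le:
  fixes A :: "complex mat"
  assumes A: "A \<in> carrier_mat n n" and le: "\<And>i j. i < n \<Longrightarrow> j < n \<Longrightarrow> norm (A $$ (i, j)) \<le> 1"
    and ij: "i < n" "j < n"
  shows "norm (adj_mat A $$ (i, j)) \<le> fact n"
proof -
  have d: "dim_row A = n" "dim_col A = n" using A by auto
  have "norm (adj_mat A $$ (i, j)) = norm (Determinant.det (mat_delete A j i))"
    using ij d by (simp add: adj_mat_def cofactor_def norm_mult norm_power)
  also have "\<dots> \<le> fact (n - 1)"
  proof (rule norm_det_le_fact)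
    show "mat_delete A j i \<in> carrier_mat (n - 1) (n - 1)" by (simp add: mat_delete_def d)
    show "norm (mat_delete A j i $$ (k, l)) \<le> 1" if "k < n - 1" "l < n - 1" for k l
      using that by (auto simp: mat_delete_def d intro!: le)
  qed
  also have "\<dots> \<le> fact n" by (rule fact_mono) simp
  finally show ?thesis .
qed

lemma adj_mat_entries:
  fixes A :: "complex mat"
  assumes A: "A \<in> carrier_mat n n" and ij: "i < n" "j < n"
  shows "(\<Sum>k<n. A $$ (i, k) * adj_mat A $$ (k, j)) = (if i = j then Determinant.det A else 0)"
    and "(\<Sum>k<n. adj_mat A $$ (i, k) * A $$ (k, j)) = (if i = j then Determinant.det A else 0)"
proof -
  have d: "dim_row A = n" "dim_col A = n" "dim_row (adj_mat A) = n" "dim_col (adj_mat A) = n"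
    using A adj_mat(1)[OF A] by auto
  have "(\<Sum>k<n. A $$ (i, k) * adj_mat A $$ (k, j)) = (A * adj_mat A) $$ (i, j)"
    using ij d by (simp add: scalar_prod_def lessThan_atLeast0)
  then show "(\<Sum>k<n. A $$ (i, k) * adj_mat A $$ (k, j)) = (if i = j then Determinant.det A else 0)"
    unfolding adj_mat(2)[OF A] using ij by simp
  have "(\<Sum>k<n. adj_mat A $$ (i, k) * A $$ (k, j)) = (adj_mat A * A) $$ (i, j)"
    using ij d by (simp add: scalar_prod_def lessThan_atLeast0)
  then show "(\<Sum>k<n. adj_mat A $$ (i, k) * A $$ (k, j)) = (if i = j then Determinant.det A else 0)"
    unfolding adj_mat(3)[OF A] using ij by simp
qed

text \<open>Cramer's rule through the adjugate, whose entries are at most \<open>fact n\<close>, so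
  only the determinant can make the solution large. \<open>B\<close> is quantified after
  \<open>x\<close>: the solution is chosen once and later estimated at every radius.\<close>

lemma linear_system_bound:
  fixes A :: "complex mat" and b :: "nat \<Rightarrow> complex"
  assumes A: "A \<in> carrier_mat n n" and le: "\<And>i j. i < n \<Longrightarrow> j < n \<Longrightarrow> norm (A $$ (i, j)) \<le> 1"
    and det: "Determinant.det A \<noteq> 0"
  shows "\<exists>x. (\<forall>i<n. (\<Sum>j<n. A $$ (i, j) * x j) = b i) \<and>
    (\<forall>B. (\<forall>i<n. norm (b i) \<le> B) \<longrightarrow> (\<forall>j<n. norm (x j) \<le> real n * fact n * B / norm (Determinant.det A)))"
proof -
  define x where "x j = (\<Sum>k<n. adj_mat A $$ (j, k) * b k) / Determinant.det A" for j
  have "(\<Sum>j<n. A $$ (i, j) * x j) = b i" if i: "i < n" for i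
  proof -
    have "(\<Sum>j<n. A $$ (i, j) * x j) = (\<Sum>j<n. \<Sum>k<n. A $$ (i, j) * adj_mat A $$ (j, k) * b k) / Determinant.det A"
      unfolding x_def by (simp add: sum_divide_distrib sum_distrib_left mult.assoc)
    also have "\<dots> = (\<Sum>k<n. (\<Sum>j<n. A $$ (i, j) * adj_mat A $$ (j, k)) * b k) / Determinant.det A"
      unfolding sum_distrib_right by (subst sum.swap) simp
    also have "\<dots> = (\<Sum>k<n. if k = i then Determinant.det A * b k else 0) / Determinant.det A"
      by (intro arg_cong2[of _ _ _ _ "(/)"] sum.cong refl) (subst adj_mat_entries[OF A], use i in auto)
    also have "\<dots> = b i" using i det by simp
    finally show ?thesis .
  qed
  moreover have "norm (x j) \<le> real n * fact n * B / norm (Determinant.det A)"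
    if B: "\<forall>i<n. norm (b i) \<le> B" and j: "j < n" for B j
  proof -
    have "norm (\<Sum>k<n. adj_mat A $$ (j, k) * b k) \<le> (\<Sum>k<n. fact n * B)"
    proof (rule sum_norm_le)
      fix k assume "k \<in> {..<n}"
      then show "norm (adj_mat A $$ (j, k) * b k) \<le> fact n * B"
        unfolding norm_mult using B j by (intro mult_mono norm_adj_mat_le[OF A le]) auto
    qed
    then show ?thesis unfolding x_def norm_divide by (intro divide_right_mono) auto
  qed
  ultimately show ?thesis by blast
qed

lemma linear_system_unique:
  fixes A :: "complex mat" and x :: "nat \<Rightarrow> complex"
  assumes A: "A \<in> carrier_mat n n" and det: "Determinant.det A \<noteq> 0"
    and eq: "\<And>i. i < n \<Longrightarrow> (\<Sum>j<n. A $$ (i, j) * x j) = 0" and k: "k < n"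
  shows "x k = 0"
proof -
  have "0 = (\<Sum>i<n. adj_mat A $$ (k, i) * (\<Sum>j<n. A $$ (i, j) * x j))" using eq by simp
  also have "\<dots> = (\<Sum>j<n. (\<Sum>i<n. adj_mat A $$ (k, i) * A $$ (i, j)) * x j)"
    unfolding sum_distrib_left sum_distrib_right by (subst sum.swap) (simp add: mult.assoc)
  also have "\<dots> = (\<Sum>j<n. if j = k then Determinant.det A * x j else 0)"
    by (intro sum.cong refl) (subst adj_mat_entries[OF A], use k in auto)
  also have "\<dots> = Determinant.det A * x k" using k by simp
  finally show ?thesis using det by simp
qed

section \<open>The Goursat problem\<close>

text \<open>In the finite case both radii are scaled by the same \<open>sqrt (s / (T * r))\<close>.
  If exactly one is infinite, half of the finite one is taken and the other supplies the
  rest.\<close>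

lemma ereal_mult_factor:
  fixes \<tau> R :: ereal
  assumes "\<tau> > 0" "R > 0" "s > 0" "ereal s < \<tau> * R"
  obtains t \<sigma> where "t > 0" "ereal t < \<tau>" "\<sigma> > 0" "ereal \<sigma> < R" "s \<le> t * \<sigma>"
proof (cases \<tau>; cases R)
  fix T r assume Tr: "\<tau> = ereal T" "R = ereal r"
  have T: "T > 0" "r > 0" "s < T * r" using assms Tr by auto
  define \<theta> where "\<theta> = sqrt (s / (T * r))"
  have th: "\<theta> > 0" "\<theta> < 1" using T assms(3) by (auto simp: \<theta>_def)
  have "\<theta> * \<theta> = s / (T * r)" using T assms(3) by (simp add: \<theta>_def)
  then have "s = (T * \<theta>) * (r * \<theta>)" using T by (simp add: field_simps)
  then show ?thesis using that[of "T * \<theta>" "r * \<theta>"] T th by (simp add: Tr)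
next
  fix T assume Tr: "\<tau> = ereal T" "R = \<infinity>"
  then show ?thesis using assms that[of "T / 2" "2 * s / T"] by simp
next
  fix r assume Tr: "\<tau> = \<infinity>" "R = ereal r"
  then show ?thesis using assms that[of "2 * s / r" "r / 2"] by simp
next
  assume "\<tau> = \<infinity>" "R = \<infinity>"
  then show ?thesis using assms that[of 1 s] by simp
qed (use assms in auto)

lemma Mmat_carrier: "Mmat m p a \<in> carrier_mat (2*p) (2*p)"
  by (simp add: Mmat_def)

text \<open>The z-exponent of column \<open>j\<close>: the free monomials of degree
  \<open>m + 2 * p\<close> have z-exponent below \<open>p\<close> or w-exponent below
  \<open>p\<close>, the latter meaning z-exponent from \<open>m + p + 1\<close> on.\<close>

definition expo :: "nat \<Rightarrow> nat \<Rightarrow> nat \<Rightarrow> nat" where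
  "expo m p j = (if j < p then j else m + j + 1)"

lemma Mmat_entry:
  "i < 2*p \<Longrightarrow> j < 2*p \<Longrightarrow> Mmat m p a $$ (i, j) = node a i ^ expo m p j"
  by (simp add: Mmat_def node_def expo_def)

lemma norm_Mmat_entry: "i < 2*p \<Longrightarrow> j < 2*p \<Longrightarrow> norm (Mmat m p a $$ (i, j)) \<le> 1"
  by (simp add: Mmat_entry norm_power norm_node)

text \<open>The liminf controls all but finitely many determinants. The remaining ones are nonzero
  and are covered by a smaller constant; the member 1 of \<open>S\<close> keeps that constant at
  most 1 for the tail.\<close>

lemma det_Mmat_lower_bound:
  assumes nz: "\<And>m. Determinant.det (Mmat m p a) \<noteq> 0" and t: "t > 0" "ereal t < tau p a"
  obtains \<kappa> where "\<kappa> > 0" "\<And>m. \<kappa> * t ^ m \<le> norm (Determinant.det (Mmat m p a))"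
proof -
  let ?d = "\<lambda>m. norm (Determinant.det (Mmat m p a))"
  have "\<forall>\<^sub>F m in sequentially. ereal t < ereal (?d m powr (1 / real m))"
    using t(2) unfolding tau_def by (rule less_LiminfD)
  then obtain M where M: "\<And>m. m \<ge> M \<Longrightarrow> t < ?d m powr (1 / real m)"
    unfolding eventually_sequentially by auto
  have big: "t ^ m \<le> ?d m" if "m \<ge> M" "m > 0" for m
  proof -
    have "t ^ m \<le> (?d m powr (1 / real m)) ^ m"
      using M[OF that(1)] t by (intro power_mono) auto
    also have "\<dots> = ?d m" using nz[of m] that(2) by (simp add: powr_powr flip: powr_realpow)
    finally show ?thesis .
  qed
  define S where "S = insert 1 ((\<lambda>m. ?d m / t ^ m) ` {..M})"
  have S: "finite S" "S \<noteq> {}" by (auto simp: S_def)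
  have "\<forall>x\<in>S. x > 0" using nz t by (auto simp: S_def)
  then have k0: "Min S > 0" using S by simp
  have "Min S * t ^ m \<le> ?d m" for m
  proof (cases "m \<le> M")
    case True
    then have "?d m / t ^ m \<in> S" unfolding S_def by auto
    then have "Min S \<le> ?d m / t ^ m" using S(1) by simp
    then show ?thesis using t by (simp add: field_simps)
  next
    case False
    have "Min S \<le> 1" using S(1) by (simp add: S_def)
    then have "Min S * t ^ m \<le> 1 * t ^ m" using t by (intro mult_right_mono) auto
    also have "\<dots> \<le> ?d m" using big[of m] False by simp
    finally show ?thesis .
  qed
  then show ?thesis using that k0 by blast
qed

text \<open>Meant for the determinants, which are bounded by \<open>fact (2 * p)\<close>: every
  \<open>t\<close> obtained from the liminf is at most 1.\<close>

lemma power_lower_bound_imp_le_1: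
  fixes t :: real
  assumes "\<kappa> > 0" "t > 0" "\<And>m. \<kappa> * t ^ m \<le> C"
  shows "t \<le> 1"
proof (rule ccontr)
  assume "\<not> t \<le> 1"
  then obtain m where "C / \<kappa> < t ^ m" using real_arch_pow[of t] by auto
  then have "C < \<kappa> * t ^ m" using assms(1) by (simp add: field_simps)
  then show False using assms(3)[of m] by simp
qed

lemma sum_split_expo:
  fixes g :: "nat \<Rightarrow> complex"
  shows "(\<Sum>k\<le>m + 2*p. g k) = (\<Sum>j<2*p. g (expo m p j)) + (\<Sum>k=p..m+p. g k)"
proof -
  have eq: "{..m + 2*p} = ({..<p} \<union> {p..m+p}) \<union> {m+p+1..m+2*p}" by auto
  have "(\<Sum>k\<le>m + 2*p. g k) = sum g ({..<p} \<union> {p..m+p}) + (\<Sum>k=m+p+1..m+2*p. g k)"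
    unfolding eq by (rule sum.union_disjoint) auto
  moreover have "sum g ({..<p} \<union> {p..m+p}) = (\<Sum>k<p. g k) + (\<Sum>k=p..m+p. g k)"
    by (rule sum.union_disjoint) auto
  moreover have "(\<Sum>j<2*p. g (expo m p j)) = (\<Sum>j<p. g j) + (\<Sum>k=m+p+1..m+2*p. g k)"
  proof -
    have eq': "{..<2*p} = {..<p} \<union> {p..<2*p}" by auto
    have "(\<Sum>j<2*p. g (expo m p j)) = (\<Sum>j<p. g (expo m p j)) + (\<Sum>j=p..<2*p. g (expo m p j))"
      unfolding eq' by (rule sum.union_disjoint) auto
    moreover have "(\<Sum>j<p. g (expo m p j)) = (\<Sum>j<p. g j)"
      by (intro sum.cong) (auto simp: expo_def)
    moreover have "(\<Sum>j=p..<2*p. g (expo m p j)) = (\<Sum>k=m+p+1..m+2*p. g k)"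
      by (rule sum.reindex_bij_witness[of _ "\<lambda>k. k - m - 1" "\<lambda>j. m + j + 1"]) (auto simp: expo_def)
    ultimately show ?thesis by simp
  qed
  ultimately show ?thesis by simp
qed

lemma expo_cases:
  assumes "k + l = m + 2*p" "\<not> (p \<le> k \<and> p \<le> l)"
  obtains j where "j < 2*p" "k = expo m p j"
proof (cases "k < p")
  case True then show ?thesis using that[of k] by (simp add: expo_def)
next
  case False
  then show ?thesis using assms that[of "k - m - 1"] by (auto simp: expo_def)
qed

lemma hpart_at_node: "hpart c N A 1 = (\<Sum>k\<le>N. c k (N - k) * A ^ k)"
  by (simp add: hpart_def)

text \<open>The degree \<open>N\<close> part is determined by its values on the lines: for \<open>N < 2p\<close> it has too many
  roots, for \<open>N \<ge> 2p\<close> its unknown coefficients satisfy a linear system with an invertible matrix.\<close>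

lemma coeff_eq_0_if_zero_at_nodes:
  assumes inj: "inj_on a {1..2*p-1}"
    and nz: "\<And>m. Determinant.det (Mmat m p a) \<noteq> 0"
    and mid: "\<And>k l. p \<le> k \<Longrightarrow> p \<le> l \<Longrightarrow> e k l = 0"
    and zero: "\<And>i N. i < 2*p \<Longrightarrow> hpart e N (node a i) 1 = 0"
  shows "e k l = 0"
proof (cases "k + l < 2*p")
  case True
  show ?thesis
  proof (rule ccontr)
    assume "e k l \<noteq> 0"
    let ?N = "k + l" and ?Z = "{z. (\<Sum>i\<le>k + l. e i (k + l - i) * z ^ i) = 0}"
    have "\<exists>i. i \<le> ?N \<and> e i (?N - i) \<noteq> 0" using \<open>e k l \<noteq> 0\<close> by (intro exI[of _ k]) simp
    then have Z: "finite ?Z" "card ?Z \<le> ?N" using polyfun_rootbound[of ?N "\<lambda>i. e i (?N - i)"] by auto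
    have "node a ` {..<2*p} \<subseteq> ?Z" using zero[of _ ?N] by (auto simp: hpart_at_node)
    then have "card (node a ` {..<2*p}) \<le> card ?Z" using Z(1) by (intro card_mono)
    then show False using Z(2) True card_image[OF inj_on_node[OF inj]] by simp
  qed
next
  case False
  then obtain m where m: "k + l = m + 2*p" by (metis add.commute le_Suc_ex not_less)
  show ?thesis
  proof (cases "p \<le> k \<and> p \<le> l")
    case True then show ?thesis using mid by simp
  next
    case False
    then obtain j where j: "j < 2*p" "k = expo m p j" using expo_cases[OF m] by blast
    let ?x = "\<lambda>j. e (expo m p j) (m + 2*p - expo m p j)"
    have "?x j = 0"
    proof (rule linear_system_unique[OF Mmat_carrier nz _ j(1), where x = ?x])
      fix i assume i: "i < 2*p"
      have "0 = hpart e (m + 2*p) (node a i) 1" using zero[OF i] by simp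
      also have "\<dots> = (\<Sum>j<2*p. ?x j * node a i ^ expo m p j)
          + (\<Sum>k=p..m+p. e k (m + 2*p - k) * node a i ^ k)"
        unfolding hpart_at_node by (rule sum_split_expo)
      also have "(\<Sum>k=p..m+p. e k (m + 2*p - k) * node a i ^ k) = 0"
        by (intro sum.neutral) (auto simp: mid)
      also have "(\<Sum>j<2*p. ?x j * node a i ^ expo m p j) = (\<Sum>j<2*p. Mmat m p a $$ (i, j) * ?x j)"
        using i by (intro sum.cong) (auto simp: Mmat_entry)
      finally show "(\<Sum>j<2*p. Mmat m p a $$ (i, j) * ?x j) = 0" by simp
    qed
    moreover have "m + 2*p - expo m p j = l" using m j by simp
    ultimately show ?thesis using j by simp
  qed
qed

text \<open>The coefficients with \<open>k, l \<ge> p\<close> are forced by \<open>\<Delta>\<^sup>p u = f\<close>, the others are the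
  coordinates of a polyharmonic polynomial and are obtained from the values of \<open>g\<close> on the lines.\<close>

lemma goursat_coefficients:
  assumes "R > 0" and nz: "\<And>m. Determinant.det (Mmat m p a) \<noteq> 0"
    and tau: "tau p a > 0" and cf: "geom_bdd R cf" and cg: "geom_bdd R cg"
  obtains cu where "geom_bdd (tau p a * R) cu"
    and "\<And>k l. 4 ^ p * (fact (k + p) / fact k) * (fact (l + p) / fact l) * cu (k + p) (l + p) = cf k l"
    and "\<And>i N. i < 2*p \<Longrightarrow> hpart cu N (node a i) 1 = hpart cg N (node a i) 1"
proof -
  \<comment> \<open>Inverts the factor of \<open>zrep_lap_funpow\<close>, with both indices shifted
    back by \<open>p\<close>.\<close>
  define v where "v k l = cf (k - p) (l - p) * (fact (k - p) / fact k) * (fact (l - p) / fact l) / 4 ^ p" for k l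
  \<comment> \<open>What the free monomials must contribute on line \<open>i\<close>: the value of
    \<open>g\<close> minus that of the forced block.\<close>
  define b where "b m i = hpart cg (m + 2*p) (node a i) 1
      - (\<Sum>k=p..m+p. v k (m + 2*p - k) * node a i ^ k)" for m i
  let ?n = "2*p" and ?d = "\<lambda>m. norm (Determinant.det (Mmat m p a))"
  have ex: "\<forall>m. \<exists>x. (\<forall>i<?n. (\<Sum>j<?n. Mmat m p a $$ (i, j) * x j) = b m i) \<and>
    (\<forall>B. (\<forall>i<?n. norm (b m i) \<le> B) \<longrightarrow> (\<forall>j<?n. norm (x j) \<le> real ?n * fact ?n * B / ?d m))"
    by (intro allI linear_system_bound[OF Mmat_carrier norm_Mmat_entry nz])
  obtain x where x: "\<And>m i. i < ?n \<Longrightarrow> (\<Sum>j<?n. Mmat m p a $$ (i, j) * x m j) = b m i"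
    "\<And>m B j. (\<And>i. i < ?n \<Longrightarrow> norm (b m i) \<le> B) \<Longrightarrow> j < ?n \<Longrightarrow> norm (x m j) \<le> real ?n * fact ?n * B / ?d m"
    using choice[OF ex] by blast
  \<comment> \<open>Below degree \<open>2 * p\<close> the equation imposes nothing and the
    coefficients of \<open>g\<close> are copied. In the last branch \<open>2 * p - 1 - l\<close>
    inverts \<open>expo\<close>: it is \<open>j\<close> when \<open>k = m + j + 1\<close> and
    \<open>k + l = m + 2 * p\<close>.\<close>
  define cu where "cu k l = (if k + l < 2*p then cg k l else if p \<le> k \<and> p \<le> l then v k l
     else x (k + l - 2*p) (if k < p then k else 2*p - 1 - l))" for k l
  have cu_expo: "cu (expo m p j) (m + 2*p - expo m p j) = x m j" if "j < 2*p" for m j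
    using that by (auto simp: cu_def expo_def)
  have cu_v: "cu k l = v k l" if "p \<le> k" "p \<le> l" for k l
    using that by (simp add: cu_def)
  have nodes: "hpart cu N (node a i) 1 = hpart cg N (node a i) 1" if i: "i < 2*p" for i N
  proof (cases "N < 2*p")
    case True
    then show ?thesis unfolding hpart_at_node by (intro sum.cong) (auto simp: cu_def)
  next
    case False
    then obtain m where m: "N = m + 2*p" by (metis add.commute le_Suc_ex not_less)
    have "hpart cu N (node a i) 1 = (\<Sum>j<2*p. cu (expo m p j) (m + 2*p - expo m p j) * node a i ^ expo m p j)
          + (\<Sum>k=p..m+p. cu k (m + 2*p - k) * node a i ^ k)"
      unfolding hpart_at_node m by (rule sum_split_expo)
    also have "(\<Sum>j<2*p. cu (expo m p j) (m + 2*p - expo m p j) * node a i ^ expo m p j)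
        = (\<Sum>j<2*p. Mmat m p a $$ (i, j) * x m j)"
      using i by (intro sum.cong) (auto simp: Mmat_entry cu_expo)
    also have "\<dots> = b m i" by (rule x(1)[OF i])
    also have "(\<Sum>k=p..m+p. cu k (m + 2*p - k) * node a i ^ k) = (\<Sum>k=p..m+p. v k (m + 2*p - k) * node a i ^ k)"
      by (intro sum.cong) (auto simp: cu_v)
    finally show ?thesis by (simp add: b_def m)
  qed
  have lapl: "4 ^ p * (fact (k + p) / fact k) * (fact (l + p) / fact l) * cu (k + p) (l + p) = cf k l" for k l
    by (simp add: cu_v v_def)
  have "geom_bdd (tau p a * R) cu"
  proof (rule geom_bddI)
    fix s :: real assume s: "s > 0" "ereal s < tau p a * R"
    obtain t \<sigma> where ts: "t > 0" "ereal t < tau p a" "\<sigma> > 0" "ereal \<sigma> < R" "s \<le> t * \<sigma>"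
      using ereal_mult_factor[OF tau \<open>R > 0\<close> s] by blast
    obtain \<kappa> where \<kappa>: "\<kappa> > 0" "\<And>m. \<kappa> * t ^ m \<le> ?d m"
      using det_Mmat_lower_bound[OF nz ts(1,2)] by blast
    have "?d m \<le> fact ?n" for m by (rule norm_det_le_fact[OF Mmat_carrier norm_Mmat_entry])
    then have t1: "t \<le> 1" using power_lower_bound_imp_le_1[OF \<kappa>(1) ts(1)] \<kappa>(2) order_trans by blast
    obtain Cf where Cf: "Cf \<ge> 0" "\<And>k l. norm (cf k l) \<le> Cf / \<sigma> ^ (k + l)"
      using geom_bddD[OF cf ts(3,4)] by blast
    obtain Cg where Cg: "Cg \<ge> 0" "\<And>k l. norm (cg k l) \<le> Cg / \<sigma> ^ (k + l)"
      using geom_bddD[OF cg ts(3,4)] by blast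
    \<comment> \<open>Dominates the bounds for both \<open>cg\<close> and \<open>v\<close>; the
      power of \<open>\<sigma>\<close> pays for the index shift in \<open>v\<close>.\<close>
    define D where "D = Cg + Cf * \<sigma> ^ (2*p)"
    have D: "D \<ge> 0" "Cg \<le> D" "Cf * \<sigma> ^ (2*p) \<le> D" using Cf Cg ts by (auto simp: D_def)
    have vb: "norm (v k l) \<le> Cf * \<sigma> ^ (2*p) / \<sigma> ^ (k + l)" if kl: "p \<le> k" "p \<le> l" for k l
    proof -
      have f1: "fact (j - p) / fact j \<le> (1::real)" for j by (simp add: fact_mono)
      have "norm (v k l) = norm (cf (k - p) (l - p)) * (fact (k - p) / fact k) * (fact (l - p) / fact l) / 4 ^ p"
        unfolding v_def by (simp add: norm_mult norm_divide norm_power)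
      also have "\<dots> \<le> norm (cf (k - p) (l - p)) * 1 * 1 / 1"
        using f1 by (intro frac_le mult_mono) auto
      also have "\<dots> \<le> Cf / \<sigma> ^ ((k - p) + (l - p))" using Cf(2) by simp
      also have "\<dots> = Cf * \<sigma> ^ (2*p) / \<sigma> ^ (k + l)"
      proof -
        have "\<sigma> ^ (k + l) = \<sigma> ^ (2*p) * \<sigma> ^ ((k - p) + (l - p))"
          using kl by (simp flip: power_add)
        then show ?thesis using ts(3) by simp
      qed
      finally show ?thesis .
    qed
    have bb: "norm (b m i) \<le> D * real (Suc (m + 2*p)) / \<sigma> ^ (m + 2*p)" if "i < 2*p" for m i
    proof -
      let ?N = "m + 2*p"
      have "norm (hpart cg ?N (node a i) 1) \<le> (\<Sum>k\<le>?N. Cg / \<sigma> ^ ?N)"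
        unfolding hpart_at_node
      proof (rule sum_norm_le)
        fix k assume "k \<in> {..?N}"
        then show "norm (cg k (?N - k) * node a i ^ k) \<le> Cg / \<sigma> ^ ?N"
          using Cg(2)[of k "?N - k"] by (simp add: norm_mult norm_power norm_node)
      qed
      moreover have "norm (\<Sum>k=p..m+p. v k (?N - k) * node a i ^ k) \<le> (\<Sum>k=p..m+p. Cf * \<sigma> ^ (2*p) / \<sigma> ^ ?N)"
      proof (rule sum_norm_le)
        fix k assume "k \<in> {p..m+p}"
        then have "p \<le> k" "p \<le> ?N - k" "k + (?N - k) = ?N" by auto
        then show "norm (v k (?N - k) * node a i ^ k) \<le> Cf * \<sigma> ^ (2*p) / \<sigma> ^ ?N"
          using vb[of k "?N - k"] by (simp add: norm_mult norm_power norm_node)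
      qed
      moreover have "(\<Sum>k=p..m+p. Cf * \<sigma> ^ (2*p) / \<sigma> ^ ?N) \<le> (\<Sum>k\<le>?N. Cf * \<sigma> ^ (2*p) / \<sigma> ^ ?N)"
        using Cf ts by (intro sum_mono2) auto
      ultimately have "norm (b m i) \<le> (\<Sum>k\<le>?N. Cg / \<sigma> ^ ?N) + (\<Sum>k\<le>?N. Cf * \<sigma> ^ (2*p) / \<sigma> ^ ?N)"
        unfolding b_def by (intro norm_triangle_le_diff) linarith
      also have "\<dots> = D * real (Suc ?N) / \<sigma> ^ ?N"
        by (simp add: D_def add_divide_distrib ring_distribs mult_ac)
      finally show ?thesis .
    qed
    define E where "E = real ?n * fact ?n * D / \<kappa>"
    have E: "E \<ge> 0" using D \<kappa> by (simp add: E_def)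
    have xb: "norm (x m j) \<le> E * real (Suc (m + 2*p)) / s ^ (m + 2*p)" if "j < 2*p" for m j
    proof -
      let ?N = "m + 2*p"
      have "norm (x m j) \<le> real ?n * fact ?n * (D * real (Suc ?N) / \<sigma> ^ ?N) / ?d m"
        by (rule x(2)[OF bb that])
      also have "\<dots> \<le> real ?n * fact ?n * (D * real (Suc ?N) / \<sigma> ^ ?N) / (\<kappa> * t ^ m)"
        using \<kappa> D ts by (intro divide_left_mono) (auto intro!: mult_pos_pos simp: nz)
      also have "\<dots> = E * real (Suc ?N) / (\<sigma> ^ ?N * t ^ m)" by (simp add: E_def mult_ac)
      \<comment> \<open>Here the radius is lost: the data contribute \<open>\<sigma> ^ ?N\<close>,
        the determinant \<open>t ^ m\<close>. As \<open>t \<le> 1\<close>, \<open>t ^ m\<close> is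
        at least \<open>t ^ ?N\<close>, and \<open>t * \<sigma>\<close> is at least
        \<open>s\<close>.\<close>
      also have "\<dots> \<le> E * real (Suc ?N) / s ^ ?N"
      proof (rule divide_left_mono)
        have "s ^ ?N \<le> (t * \<sigma>) ^ ?N" using s ts by (intro power_mono) auto
        also have "\<dots> = \<sigma> ^ ?N * t ^ ?N" by (simp add: power_mult_distrib)
        also have "\<dots> \<le> \<sigma> ^ ?N * t ^ m"
          using ts t1 by (intro mult_left_mono power_decreasing) auto
        finally show "s ^ ?N \<le> \<sigma> ^ ?N * t ^ m" .
      qed (use E s ts in auto)
      finally show ?thesis .
    qed
    \<comment> \<open>Needed for the coefficients that never meet a determinant and are bounded at
      radius \<open>\<sigma>\<close>.\<close>
    have "s \<le> \<sigma>"
    proof -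
      have "t * \<sigma> \<le> 1 * \<sigma>" using t1 ts by (intro mult_right_mono) auto
      then show ?thesis using ts(5) by simp
    qed
    have sig: "D / \<sigma> ^ N \<le> (D + E) * real (Suc N) / s ^ N" for N
    proof -
      have "D / \<sigma> ^ N \<le> D / s ^ N"
        using \<open>s \<le> \<sigma>\<close> s ts D by (intro divide_left_mono power_mono) auto
      also have "\<dots> \<le> (D + E) * real (Suc N) / s ^ N"
        using mult_mono[of D "D + E" 1 "real (Suc N)"] D E s by (intro divide_right_mono) auto
      finally show ?thesis .
    qed
    have "norm (cu k l) \<le> (D + E) * real (Suc (k + l)) / s ^ (k + l)" for k l
    proof (cases "k + l < 2*p")
      case True
      then have "norm (cu k l) \<le> Cg / \<sigma> ^ (k + l)" using Cg(2) by (simp add: cu_def)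
      also have "\<dots> \<le> D / \<sigma> ^ (k + l)" using D ts by (intro divide_right_mono) auto
      also note sig
      finally show ?thesis .
    next
      case False
      then obtain m where m: "k + l = m + 2*p" by (metis add.commute le_Suc_ex not_less)
      show ?thesis
      proof (cases "p \<le> k \<and> p \<le> l")
        case True
        then have "norm (cu k l) \<le> Cf * \<sigma> ^ (2*p) / \<sigma> ^ (k + l)" using vb cu_v by simp
        also have "\<dots> \<le> D / \<sigma> ^ (k + l)" using D ts by (intro divide_right_mono) auto
        also note sig
        finally show ?thesis .
      next
        case False
        then obtain j where j: "j < 2*p" "k = expo m p j" using expo_cases[OF m] by blast
        have "l = m + 2*p - expo m p j" using m j by simp
        then have "cu k l = x m j" using cu_expo[OF j(1)] j(2) by simp
        then have "norm (cu k l) \<le> E * real (Suc (k + l)) / s ^ (k + l)"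
          using xb[OF j(1), of m] by (simp add: m)
        also have "\<dots> \<le> (D + E) * real (Suc (k + l)) / s ^ (k + l)"
          using D s by (intro divide_right_mono mult_right_mono) auto
        finally show ?thesis .
      qed
    qed
    then show "\<exists>C. \<forall>k l. norm (cu k l) \<le> C * real (Suc (k + l)) / s ^ (k + l)" by blast
  qed
  then show ?thesis using that lapl nodes by blast
qed

section \<open>Existence and uniqueness of the solution\<close>

theorem theorem2p1:
  fixes p :: nat and a :: "nat \<Rightarrow> real" and R :: ereal
    and f g :: "real \<times> real \<Rightarrow> complex"
  assumes "p > 0"
    and "inj_on a {1..2*p-1}"
    and "\<forall>j\<in>{1..2*p-1}. a j \<noteq> 0"
    and "0 < R"
    and "\<forall>m. Determinant.det (Mmat m p a) \<noteq> 0"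
    and "tau p a > 0"
    and "f \<in> AB R" and "g \<in> AB R"
  shows "\<exists>u \<in> AB (tau p a * R).
           (\<forall>z \<in> Bdisc R \<inter> Bdisc (tau p a * R). (lap ^^ p) u z = f z) \<and>
           Pdvd p a (\<lambda>z. u z - g z) \<and>
           (\<forall>v \<in> AB (tau p a * R).
              (\<forall>z \<in> Bdisc R \<inter> Bdisc (tau p a * R). (lap ^^ p) v z = f z) \<and>
              Pdvd p a (\<lambda>z. v z - g z)
              \<longrightarrow> (\<forall>z \<in> Bdisc (tau p a * R). v z = u z))"
proof -
  let ?\<rho> = "tau p a * R"
  have nz: "Determinant.det (Mmat m p a) \<noteq> 0" for m using assms(5) by simp
  have \<rho>: "?\<rho> > 0" using assms(4,6) by (simp add: ereal_zero_less_0_iff)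
  \<comment> \<open>Disc on which the series of \<open>f\<close>, \<open>g\<close> and the solution
    can be compared; it is the intersection of discs in the statement.\<close>
  define \<delta> where "\<delta> = min R ?\<rho>"
  have \<delta>: "\<delta> > 0" "\<delta> \<le> R" "\<delta> \<le> ?\<rho>" using \<rho> assms(4) by (auto simp: \<delta>_def)
  have \<delta>_iff: "z \<in> Bdisc \<delta> \<longleftrightarrow> z \<in> Bdisc R \<inter> Bdisc ?\<rho>" for z
    by (auto simp: in_Bdisc_iff \<delta>_def)
  obtain cf where cf: "zrep R f cf" using AB_imp_zrep[OF assms(7)] .
  obtain cg where cg: "zrep R g cg" using AB_imp_zrep[OF assms(8)] .
  have "geom_bdd R cf" "geom_bdd R cg" using cf cg by (auto simp: zrep_def)
  then obtain cu where cu: "geom_bdd ?\<rho> cu"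
    "\<And>k l. 4 ^ p * (fact (k + p) / fact k) * (fact (l + p) / fact l) * cu (k + p) (l + p) = cf k l"
    "\<And>i N. i < 2*p \<Longrightarrow> hpart cu N (node a i) 1 = hpart cg N (node a i) 1"
    using goursat_coefficients[OF assms(4) nz assms(6)] by blast
  define u where "u = (\<lambda>z. zser cu (Complex (fst z) (snd z)))"
  have u: "zrep ?\<rho> u cu" unfolding u_def using cu(1) by (rule zrep_zser)
  have diff: "zrep \<delta> (\<lambda>z. w z - g z) (\<lambda>k l. 1 * cw k l + (- 1) * cg k l)" if "zrep ?\<rho> w cw" for w cw
    using zrep_lincomb[OF zrep_mono[OF that \<delta>(3)] zrep_mono[OF cg \<delta>(2)], of 1 "-1"] by simp
  have "u \<in> AB ?\<rho>" using u \<rho> by (rule zrep_in_AB)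
  moreover have "(lap ^^ p) u z = f z" if z: "z \<in> Bdisc R \<inter> Bdisc ?\<rho>" for z
  proof -
    \<comment> \<open>By \<open>cu(2)\<close> the coefficient family of \<open>(lap ^^ p) u\<close>
      is \<open>cf\<close> itself.\<close>
    have "zrep ?\<rho> ((lap ^^ p) u) cf" using zrep_lap_funpow[OF u, of p] unfolding cu(2) .
    then show ?thesis using cf z by (auto simp: zrep_def)
  qed
  moreover have "Pdvd p a (\<lambda>z. u z - g z)"
    using cu(3) by (intro PdvdI[OF assms(1,2) \<delta>(1) diff[OF u]]) (simp only: hpart_lincomb, simp)
  moreover have "v z = u z"
    if v: "v \<in> AB ?\<rho>" and lap_v: "\<And>z. z \<in> Bdisc R \<inter> Bdisc ?\<rho> \<Longrightarrow> (lap ^^ p) v z = f z"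
      and P: "Pdvd p a (\<lambda>z. v z - g z)" and z: "z \<in> Bdisc ?\<rho>" for v z
  proof -
    obtain cv where cv: "zrep ?\<rho> v cv" using AB_imp_zrep[OF v] .
    let ?L = "\<lambda>k l. 4 ^ p * (fact (k + p) / fact k) * (fact (l + p) / fact l) * cv (k + p) (l + p)"
    have L: "zrep \<delta> ((lap ^^ p) v) ?L" using zrep_mono[OF zrep_lap_funpow[OF cv] \<delta>(3)] .
    have f: "zrep \<delta> f cf" using zrep_mono[OF cf \<delta>(2)] .
    \<comment> \<open>The equation for \<open>v\<close> on the disc of radius
      \<open>\<delta>\<close> already fixes the coefficients, which then determine \<open>v\<close>
      on all of \<open>Bdisc ?\<rho>\<close>.\<close>
    have "?L = cf"
    proof (rule zser_eq_imp_coeff_eq[OF _ _ \<delta>(1)])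
      show "geom_bdd \<delta> ?L" "geom_bdd \<delta> cf" using L f by (auto simp: zrep_def)
      fix w :: complex assume "ereal (norm w) < \<delta>"
      then have w: "(Re w, Im w) \<in> Bdisc \<delta>" by (simp add: in_Bdisc_iff)
      then have "zser ?L w = (lap ^^ p) v (Re w, Im w)" "zser cf w = f (Re w, Im w)"
        using L f by (auto simp: zrep_def)
      then show "zser ?L w = zser cf w" using lap_v w \<delta>_iff by simp
    qed
    then have Lk: "?L k l = cf k l" for k l by (rule fun_cong[OF fun_cong])
    have mid: "cv k l = cu k l" if "p \<le> k" "p \<le> l" for k l
    proof -
      have "4 ^ p * (fact (k - p + p) / fact (k - p)) * (fact (l - p + p) / fact (l - p)) * (cv (k - p + p) (l - p + p) - cu (k - p + p) (l - p + p)) = 0"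
        unfolding right_diff_distrib Lk cu(2) by simp
      then show ?thesis using that by simp
    qed
    have nodes: "hpart cv N (node a i) 1 = hpart cu N (node a i) 1" if "i < 2*p" for i N
      using PdvdD[OF P \<delta>(1) diff[OF cv] that, of N] cu(3)[OF that, of N] unfolding hpart_lincomb by simp
    \<comment> \<open>The homogeneous problem: the difference has no forced coefficients and
      vanishes at every node in every degree.\<close>
    have "1 * cv k l + (- 1) * cu k l = 0" for k l
      by (rule coeff_eq_0_if_zero_at_nodes[OF assms(2) nz, where e = "\<lambda>k l. 1 * cv k l + (- 1) * cu k l"])
        (simp_all only: hpart_lincomb nodes mid, simp_all)
    then have "cv = cu" by (intro ext) simp
    then show ?thesis using cv u z by (auto simp: zrep_def)
  qed
  ultimately show ?thesis by blast
qed

end
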